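(* Let $W_0\in\mathfrak{su}(N)$ have eigenvalues $\lambda_1(W_0),\dots,\lambda_N(W_0)$ with $|\lambda_1(W_0)|\ge\dots\ge|\lambda_N(W_0)|$, let $1\le r\le N$, $S_0=\mathrm{diag}(\lambda_1(W_0),\dots,\lambda_r(W_0))$, let $U_0\in \mathrm{St}(r,\mathbb{C}^N)$ have as columns corresponding orthonormal eigenvectors, and let $Y_0=U_0S_0U_0^*$. Let $W(t)$ be the solution of $\dot W+[P(W),W]_N=0$ with $W(t_0)=W_0$. Let $U_\tau$, $\tau\ge 0$, be produced from $U_0$ by the explicit RK-MK scheme described in the context, applied to $\dot U+\hbar_N^{-1}P(US_0U^* )U=0$, and let $Y_\tau=U_\tau S_0U_\tau^*$. Then, for every $\tau$, $U_\tau\in \mathrm{St}(r,\mathbb{C}^N)$ and $Y_\tau\in\mathfrak{u}(N)$ belongs to the co-adjoint orbit $\mathcal{O}_{\mathrm{U}(N)}(Y_0)=\{RY_0R^*:R\in \mathrm{U}(N)\}$; in particular the discrete flow of $Y_\tau$ is isospectral and the Casimir functions are exactly preserved, $C_k(Y_\tau)=C_k(Y_0)$ for $1\le k\le N$, and $$|C_k(W(t_\tau))-C_k(Y_\tau)|=\frac{4\pi}{N}\Bigl|\sum_{j=r+1}^N\lambda_j(W_0)^k\Bigr|,\qquad 1\le k\le N.$$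
   Context: Let $N\ge 2$, $\hbar_N=2/\sqrt{N^2-1}$ and $[A,B]_N=\hbar_N^{-1}(AB-BA)$. $\mathfrak{u}(N)$ denotes the skew-Hermitian $N\times N$ matrices, $\mathfrak{su}(N)$ the traceless ones, $\mathrm{St}(r,\mathbb{C}^N)=\{U\in\mathbb{C}^{N\times r}:U^*U=I_r\}$, and $C_k(X)=\frac{4\pi}{N}\mathrm{Tr}(X^k)$. Put $s=(N-1)/2$ and, for $0\le\ell\le N-1$, $-\ell\le m\le\ell$, let $T^N_{\ell,m}\in\mathbb{C}^{N\times N}$ (rows and columns indexed by $m_1,m_2\in\{-s,\dots,s\}$) be $$(T^N_{\ell,m})_{m_1,m_2}=\sqrt{\tfrac{N}{4\pi}}\,(-1)^{s-m_1}\sqrt{2\ell+1}\begin{pmatrix}s&\ell&s\\-m_1&m&m_2\end{pmatrix}$$ (Wigner 3j-symbol), a basis of $\mathbb{C}^{N\times N}$. The discrete Laplacian $\Delta_N$ is the linear map with $\Delta_NT^N_{\ell,m}=-\ell(\ell+1)T^N_{\ell,m}$; it preserves $\mathfrak{u}(N)$ and its kernel consists of multiples of the identity. $\Delta_N^{-1}$ is its inverse on traceless matrices, extended linearly by $\Delta_N^{-1}I=0$, and $P(X)=\Delta_N^{-1}X$. The time grid is $t_\tau=t_0+\tau\Delta t$. RK-MK step. Set $\mathcal{F}_{S_0}(U)=-\hbar_N^{-1}P(US_0U^* )U$ and $\mathcal{L}_{S_0}(U)=(I-UU^* )\mathcal{F}_{S_0}(U)U^*-U\mathcal{F}_{S_0}(U)^*$.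 The coordinate map is the Cayley transform $\Psi(\Omega)=(I-\Omega/2)^{-1}(I+\Omega/2)$, with inverse right trivialized tangent $\mathrm{d}\Psi_\Omega^{-1}(A)=(I-\Omega/2)A(I+\Omega/2)$. Let $\{b_i\}_{i=1}^{N_s}$, $\{a_{i,j}\}_{i,j=1}^{N_s}$ be the real coefficients of an explicit Runge--Kutta method ($a_{i,j}=0$ for $j\ge i$). Given $U_\tau$: put $\Omega_\tau^1=0$, $U_\tau^1=U_\tau$; for $i=2,\dots,N_s$, $\Omega_\tau^i=\Delta t\sum_{j=1}^{i-1}a_{i,j}\,\mathrm{d}\Psi^{-1}_{\Omega_\tau^j}(\mathcal{L}_{S_0}(U_\tau^j))$ and $U_\tau^i=\Psi(\Omega_\tau^i)U_\tau$; then $\Omega_{\tau+1}=\Delta t\sum_{i=1}^{N_s}b_i\,\mathrm{d}\Psi^{-1}_{\Omega_\tau^i}(\mathcal{L}_{S_0}(U_\tau^i))$ and $U_{\tau+1}=\Psi(\Omega_{\tau+1})U_\tau$. *)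

theory Defs
  imports
    "HOL-Analysis.Analysis"
    "Jordan_Normal_Form.Char_Poly"
    "Jordan_Normal_Form.Gauss_Jordan_Elimination"
    "Jordan_Normal_Form.Schur_Decomposition"
begin

section \<open>Matrix spaces\<close>

definition mtrace :: "complex mat \<Rightarrow> complex" where
  "mtrace A = (\<Sum>i<dim_row A. A $$ (i, i))"

definition u_alg :: "nat \<Rightarrow> complex mat set" where
  "u_alg N = {A \<in> carrier_mat N N. mat_adjoint A = - A}"

definition su_alg :: "nat \<Rightarrow> complex mat set" where
  "su_alg N = {A \<in> u_alg N. mtrace A = 0}"

definition U_group :: "nat \<Rightarrow> complex mat set" where
  "U_group N = {R \<in> carrier_mat N N. mat_adjoint R * R = 1\<^sub>m N \<and> R * mat_adjoint R = 1\<^sub>m N}"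

definition stiefel :: "nat \<Rightarrow> nat \<Rightarrow> complex mat set" where
  "stiefel r N = {U \<in> carrier_mat N r. mat_adjoint U * U = 1\<^sub>m r}"

definition traceless :: "nat \<Rightarrow> complex mat set" where
  "traceless N = {A \<in> carrier_mat N N. mtrace A = 0}"

definition coadjoint_orbit :: "nat \<Rightarrow> complex mat \<Rightarrow> complex mat set" where
  "coadjoint_orbit N Y = {R * Y * mat_adjoint R | R. R \<in> U_group N}"

definition isospectral :: "complex mat \<Rightarrow> complex mat \<Rightarrow> bool" where
  "isospectral A B \<longleftrightarrow>
     (\<forall>e. eigenvalue A e \<longleftrightarrow> eigenvalue B e) \<and>
     (\<forall>e. Polynomial.order e (char_poly A) = Polynomial.order e (char_poly B))"

definition casimir :: "nat \<Rightarrow> nat \<Rightarrow> complex mat \<Rightarrow> complex" where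
  "casimir N k X = complex_of_real (4 * pi / real N) * mtrace (X ^\<^sub>m k)"

definition hbar :: "nat \<Rightarrow> real" where
  "hbar N = 2 / sqrt ((real N)\<^sup>2 - 1)"

definition bracket :: "nat \<Rightarrow> complex mat \<Rightarrow> complex mat \<Rightarrow> complex mat" where
  "bracket N A B = complex_of_real (1 / hbar N) \<cdot>\<^sub>m (A * B - B * A)"


section \<open>Wigner 3j-symbols and the discrete Laplacian\<close>

definition nfact :: "real \<Rightarrow> real" where
  "nfact x = fact (nat \<lfloor>x\<rfloor>)"

text \<open>Racah's formula for
  $\begin{pmatrix} j_1 & j_2 & j_3 \cr m_1 & m_2 & m_3 \end{pmatrix}$. The arguments are integers or
  half-integers; outside the selection rules the symbol vanishes, and inside them every argument of
  \<open>nfact\<close> is a nonnegative integer.\<close>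

definition wigner3j :: "real \<Rightarrow> real \<Rightarrow> real \<Rightarrow> real \<Rightarrow> real \<Rightarrow> real \<Rightarrow> real" where
  "wigner3j j1 j2 j3 m1 m2 m3 =
    (if m1 + m2 + m3 = 0 \<and> \<bar>j1 - j2\<bar> \<le> j3 \<and> j3 \<le> j1 + j2 \<and> j1 + j2 + j3 \<in> \<int> \<and>
        (\<forall>(j, m) \<in> {(j1, m1), (j2, m2), (j3, m3)}. \<bar>m\<bar> \<le> j \<and> j - m \<in> \<int> \<and> j + m \<in> \<int>)
     then (-1) powi \<lfloor>j1 - j2 - m3\<rfloor>
        * sqrt (nfact (j1 + j2 - j3) * nfact (j1 - j2 + j3) * nfact (- j1 + j2 + j3)
            / nfact (j1 + j2 + j3 + 1))
        * sqrt (nfact (j1 - m1) * nfact (j1 + m1) * nfact (j2 - m2) * nfact (j2 + m2)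
            * nfact (j3 - m3) * nfact (j3 + m3))
        * (\<Sum>k | real k \<le> j1 + j2 - j3 \<and> real k \<le> j1 - m1 \<and> real k \<le> j2 + m2
              \<and> j2 - j3 - m1 \<le> real k \<and> j1 - j3 + m2 \<le> real k.
            (-1) ^ k /
              (fact k * nfact (j3 - j2 + m1 + real k) * nfact (j3 - j1 - m2 + real k)
               * nfact (j1 + j2 - j3 - real k) * nfact (j1 - m1 - real k)
               * nfact (j2 + m2 - real k)))
     else 0)"

definition spin :: "nat \<Rightarrow> real" where
  "spin N = (real N - 1) / 2"

text \<open>Matrix index \<open>i \<in> {0..<N}\<close> carries the quantum number \<open>i - s \<in> {-s, \<dots>, s}\<close>.\<close>

definition qnum :: "nat \<Rightarrow> nat \<Rightarrow> real" where
  "qnum N i = real i - spin N"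

definition T_basis :: "nat \<Rightarrow> nat \<Rightarrow> int \<Rightarrow> complex mat" where
  "T_basis N l m = mat N N (\<lambda>(i1, i2).
     let s = spin N; m1 = qnum N i1; m2 = qnum N i2 in
     complex_of_real
       (sqrt (real N / (4 * pi)) * (-1) powi \<lfloor>s - m1\<rfloor> * sqrt (2 * real l + 1)
        * wigner3j s (real l) s (- m1) (of_int m) m2))"

definition linear_on_mats :: "nat \<Rightarrow> (complex mat \<Rightarrow> complex mat) \<Rightarrow> bool" where
  "linear_on_mats N D \<longleftrightarrow>
     (\<forall>A \<in> carrier_mat N N. D A \<in> carrier_mat N N) \<and>
     (\<forall>A \<in> carrier_mat N N. \<forall>B \<in> carrier_mat N N. D (A + B) = D A + D B) \<and>
     (\<forall>c. \<forall>A \<in> carrier_mat N N. D (c \<cdot>\<^sub>m A) = c \<cdot>\<^sub>m D A)"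

text \<open>Since the \<open>T_basis N l m\<close> form a basis of the \<open>N \<times> N\<close> matrices, the description is unique once
  the value outside \<open>carrier_mat N N\<close> is fixed, which is what \<open>extensional\<close> does.\<close>

definition disc_laplacian :: "nat \<Rightarrow> complex mat \<Rightarrow> complex mat" where
  "disc_laplacian N = (THE D. D \<in> extensional (carrier_mat N N) \<and> linear_on_mats N D \<and>
     (\<forall>l m. l \<le> N - 1 \<and> - int l \<le> m \<and> m \<le> int l \<longrightarrow>
        D (T_basis N l m) = (- of_nat (l * (l + 1))) \<cdot>\<^sub>m T_basis N l m))"

text \<open>The inverse of the Laplacian on traceless matrices, extended linearly by sending the identity
  to 0: it is applied to the traceless part of \<open>X\<close>.\<close>

definition disc_stream :: "nat \<Rightarrow> complex mat \<Rightarrow> complex mat" where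
  "disc_stream N X =
     the_inv_into (traceless N) (disc_laplacian N) (X - (mtrace X / of_nat N) \<cdot>\<^sub>m 1\<^sub>m N)"


section \<open>The isospectral flow\<close>

definition mat_has_derivative ::
  "nat \<Rightarrow> (real \<Rightarrow> complex mat) \<Rightarrow> complex mat \<Rightarrow> real filter \<Rightarrow> bool" where
  "mat_has_derivative N W D F \<longleftrightarrow>
     (\<forall>i<N. \<forall>j<N. ((\<lambda>t. W t $$ (i, j)) has_vector_derivative D $$ (i, j)) F)"

definition solves_euler ::
  "nat \<Rightarrow> real set \<Rightarrow> real \<Rightarrow> complex mat \<Rightarrow> (real \<Rightarrow> complex mat) \<Rightarrow> bool" where
  "solves_euler N J t0 W0 W \<longleftrightarrow>
     W t0 = W0 \<and> (\<forall>t\<in>J. W t \<in> carrier_mat N N) \<and>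
     (\<forall>t\<in>J. \<exists>W'\<in>carrier_mat N N. mat_has_derivative N W W' (at t within J) \<and>
        W' + bracket N (disc_stream N (W t)) (W t) = 0\<^sub>m N N)"


section \<open>The explicit RK-MK scheme with the Cayley transform\<close>

definition low_rank :: "complex mat \<Rightarrow> complex mat \<Rightarrow> complex mat" where
  "low_rank S U = U * S * mat_adjoint U"

definition field_F :: "nat \<Rightarrow> complex mat \<Rightarrow> complex mat \<Rightarrow> complex mat" where
  "field_F N S U =
     (- complex_of_real (1 / hbar N)) \<cdot>\<^sub>m (disc_stream N (low_rank S U) * U)"

definition field_L :: "nat \<Rightarrow> complex mat \<Rightarrow> complex mat \<Rightarrow> complex mat" where
  "field_L N S U =
     (1\<^sub>m N - U * mat_adjoint U) * field_F N S U * mat_adjoint U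
     - U * mat_adjoint (field_F N S U)"

definition cayley :: "nat \<Rightarrow> complex mat \<Rightarrow> complex mat" where
  "cayley N \<Omega> =
     the (mat_inverse (1\<^sub>m N - (1/2) \<cdot>\<^sub>m \<Omega>)) * (1\<^sub>m N + (1/2) \<cdot>\<^sub>m \<Omega>)"

definition dcayley_inv :: "nat \<Rightarrow> complex mat \<Rightarrow> complex mat \<Rightarrow> complex mat" where
  "dcayley_inv N \<Omega> A = (1\<^sub>m N - (1/2) \<cdot>\<^sub>m \<Omega>) * A * (1\<^sub>m N + (1/2) \<cdot>\<^sub>m \<Omega>)"

text \<open>Finite sums of \<open>N \<times> N\<close> matrices, taken entrywise because the type of matrices of all sizes is
  not a commutative monoid.\<close>

definition mat_sum_on :: "nat \<Rightarrow> 'i set \<Rightarrow> ('i \<Rightarrow> complex mat) \<Rightarrow> complex mat" where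
  "mat_sum_on N I f = mat N N (\<lambda>pq. \<Sum>i\<in>I. f i $$ pq)"

lemma mat_sum_on_cong [fundef_cong]:
  assumes "N = M" and "I = J" and "\<And>i. i \<in> J \<Longrightarrow> f i = g i"
  shows "mat_sum_on N I f = mat_sum_on M J g"
  unfolding mat_sum_on_def using assms by (auto intro!: sum.cong)

text \<open>\<open>rkmk_Om N S dt a U i\<close> and \<open>rkmk_U N S dt a U i\<close> are the internal stages \<open>\<Omega>\<^sup>i\<close> and \<open>U\<^sup>i\<close>,
  \<open>i \<ge> 1\<close>, of one step that starts at \<open>U\<close>.\<close>

function
  rkmk_Om :: "nat \<Rightarrow> complex mat \<Rightarrow> real \<Rightarrow> (nat \<Rightarrow> nat \<Rightarrow> real) \<Rightarrow> complex mat \<Rightarrow> nat \<Rightarrow> complex mat" and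
  rkmk_U :: "nat \<Rightarrow> complex mat \<Rightarrow> real \<Rightarrow> (nat \<Rightarrow> nat \<Rightarrow> real) \<Rightarrow> complex mat \<Rightarrow> nat \<Rightarrow> complex mat"
where
  "rkmk_Om N S dt a U i =
     (if i \<le> 1 then 0\<^sub>m N N
      else complex_of_real dt \<cdot>\<^sub>m mat_sum_on N {1..<i} (\<lambda>j.
             complex_of_real (a i j) \<cdot>\<^sub>m
               dcayley_inv N (rkmk_Om N S dt a U j) (field_L N S (rkmk_U N S dt a U j))))"
| "rkmk_U N S dt a U i =
     (if i \<le> 1 then U else cayley N (rkmk_Om N S dt a U i) * U)"
  by pat_completeness auto
termination
  by (relation "Wellfounded.measure (case_sum (\<lambda>(N, S, dt, a, U, i). 2 * i) (\<lambda>(N, S, dt, a, U, i). 2 * i + 1))")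
     auto

declare rkmk_Om.simps [simp del] rkmk_U.simps [simp del]

definition rkmk_step ::
  "nat \<Rightarrow> complex mat \<Rightarrow> real \<Rightarrow> nat \<Rightarrow> (nat \<Rightarrow> nat \<Rightarrow> real) \<Rightarrow> (nat \<Rightarrow> real) \<Rightarrow> complex mat \<Rightarrow> complex mat"
where
  "rkmk_step N S dt Ns a b U =
     cayley N (complex_of_real dt \<cdot>\<^sub>m mat_sum_on N {1..Ns} (\<lambda>i.
        complex_of_real (b i) \<cdot>\<^sub>m
          dcayley_inv N (rkmk_Om N S dt a U i) (field_L N S (rkmk_U N S dt a U i)))) * U"

end

theory Submission
  imports Defs
begin

text \<open>Everything about the scheme follows from one fact: if \<open>X\<close> is skew-Hermitian, then so is
  \<open>disc_stream N X\<close>. Granted this, the field \<open>field_L\<close> of every stage is skew-Hermitian, hence so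
  are the stages \<open>\<Omega>\<close> (\<open>rkmk_stages\<close>), their Cayley transforms are unitary, and a step multiplies
  \<open>U\<close> from the left by a unitary matrix (\<open>rkmk_step_unitary\<close>). Thus \<open>U\<close> stays on the Stiefel manifold
  and \<open>Y\<close> moves inside its coadjoint orbit.

  The fact needs a description of the discrete Laplacian other than its action on the tensor
  operators \<open>T_basis N l m\<close>. It is minus the sum of the three double commutators with the spin
  matrices, \<open>- (ad J\<^sub>x)\<^sup>2 - (ad J\<^sub>y)\<^sup>2 - (ad J\<^sub>z)\<^sup>2\<close>, which couples an entry only to its two neighbours on the same
  diagonal and visibly commutes with taking adjoints. That the tensor operators are its eigenvectors
  amounts to a three-term recurrence for the sum in Racah's formula (\<open>racah_sum_recurrence\<close>), which is
  proved by shifting the summation index.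
  The operator is symmetric for the bilinear trace pairing, so tensor operators with different
  eigenvalues are orthogonal; those with equal \<open>l\<close> live on different diagonals. They are real and
  nonzero and there are \<open>N\<^sup>2\<close> of them, hence they span. So the operator is the
  discrete Laplacian (\<open>disc_laplacian_eq\<close>), it is bijective on traceless matrices, and uniqueness of
  the preimage gives \<open>disc_stream_u_alg\<close>.

  The Casimir functions are traces of powers. Along the Euler flow \<open>W' = [W, B]\<close>, whence
  \<open>(W\<^sup>k)' = [W\<^sup>k, B]\<close> and the trace of \<open>W\<^sup>k\<close> is constant, equal to the sum of all \<open>\<lambda>\<^sub>j\<^sup>k\<close>
  (\<open>mtrace_pow_char_poly\<close>). For a Stiefel matrix \<open>U\<close> the powers of \<open>Y = U S U\<^sup>*\<close> are \<open>U S\<^sup>k U\<^sup>*\<close>, with trace the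
  sum of the first \<open>r\<close> of these terms (\<open>mtrace_low_rank_pow\<close>). The difference is the discarded tail.\<close>

section \<open>The sum in Racah's formula\<close>

text \<open>Extending the binomial coefficient by zero to negative lower arguments makes the absorption
  identity hold for every integer, so that summation ranges need no case distinctions.\<close>

definition ibinom :: "nat \<Rightarrow> int \<Rightarrow> real" where
  "ibinom q d = (if d < 0 then 0 else real (q choose nat d))"

lemma ibinom_eq_0: "d < 0 \<or> int q < d \<Longrightarrow> ibinom q d = 0"
  by (auto simp: ibinom_def)

lemma ibinom_absorb:
  "of_int d * ibinom q d = (real q - of_int d + 1) * ibinom q (d - 1)"
proof (cases "0 < d \<and> d \<le> int q")
  case True
  then obtain k where k: "d = int (Suc k)" "Suc k \<le> q"
    by (metis Suc_pred' nat_0_le nat_le_iff of_nat_0_less_iff order_less_imp_le)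
  have "Suc k * (q choose Suc k) = (q - k) * (q choose k)"
    by (metis binomial_absorb_comp binomial_absorption)
  then have "real (Suc k) * real (q choose Suc k) = real (q - k) * real (q choose k)"
    by (metis of_nat_mult)
  with k show ?thesis by (simp add: ibinom_def of_nat_diff nat_add_distrib)
next
  case False
  then consider "d \<le> 0" | "d = int q + 1" | "d > int q + 1" by linarith
  then show ?thesis by cases (auto simp: ibinom_def binomial_eq_0)
qed

text \<open>For fixed \<open>l\<close> and \<open>m\<close> these are the coefficients of a Jacobi polynomial, up to elementary factors
  and a Moebius change of variable. The product of their generating function with \<open>(1 + x)\<^sup>q\<close> is the
  generating function of \<open>racah_sum\<close> below.\<close>

definition jacobi_coeff :: "nat \<Rightarrow> int \<Rightarrow> int \<Rightarrow> real" where
  "jacobi_coeff l m k = (-1) powi k * ibinom l k * ibinom l (k - m)"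

lemma jacobi_coeff_eq_0: "k < 0 \<or> int l < k \<Longrightarrow> jacobi_coeff l m k = 0"
  by (auto simp: jacobi_coeff_def ibinom_eq_0)

lemma jacobi_coeff_step:
  "jacobi_coeff l m (k + 1) * of_int ((k + 1) * (k + 1 - m))
     = - jacobi_coeff l m k * of_int ((int l - k) * (int l - k + m))"
proof -
  have "of_int (k + 1) * ibinom l (k + 1) = of_int (int l - k) * ibinom l k"
    using ibinom_absorb[of "k + 1" l] by simp
  moreover have "of_int (k + 1 - m) * ibinom l (k + 1 - m) = of_int (int l - k + m) * ibinom l (k - m)"
    using ibinom_absorb[of "k + 1 - m" l] by (simp add: algebra_simps)
  ultimately have "(of_int (k + 1) * ibinom l (k + 1)) * (of_int (k + 1 - m) * ibinom l (k + 1 - m))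
     = (of_int (int l - k) * ibinom l k) * (of_int (int l - k + m) * ibinom l (k - m))" by simp
  moreover have "(-1::real) powi (k + 1) = - ((-1) powi k)"
    by (simp add: power_int_add)
  ultimately show ?thesis
    unfolding jacobi_coeff_def of_int_mult by (simp only:) (simp add: mult_ac)
qed

text \<open>With \<open>q = 2 s - l\<close> and \<open>i = s + m\<^sub>1\<close>, this is the alternating sum of the 3j-symbol
  \<open>(s, l, s; - m\<^sub>1, m, m\<^sub>1 - m)\<close> with its factorials collected into binomial coefficients.\<close>

definition racah_sum :: "nat \<Rightarrow> nat \<Rightarrow> int \<Rightarrow> int \<Rightarrow> real" where
  "racah_sum l q m i = (\<Sum>k\<in>{0..int l}. jacobi_coeff l m k * ibinom q (i - k))"

text \<open>One vanishing term on either side of the range turns an index shift into an identity of sums over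
  the same set.\<close>

lemma racah_sum_wide:
  "racah_sum l q m i = (\<Sum>k\<in>{-1..int l + 1}. jacobi_coeff l m k * ibinom q (i - k))"
  unfolding racah_sum_def by (rule sum.mono_neutral_left) (auto simp: jacobi_coeff_eq_0)

lemma sum_int_shift:
  fixes f :: "int \<Rightarrow> real"
  assumes "\<And>k. k < 0 \<or> L < k \<Longrightarrow> f k = 0"
  shows "(\<Sum>k\<in>{-1..L + 1}. f (k + 1)) = (\<Sum>k\<in>{-1..L + 1}. f k)"
proof -
  have "(\<Sum>k\<in>{-1..L + 1}. f (k + 1)) = (\<Sum>k\<in>{0..L + 2}. f k)"
    by (rule sum.reindex_bij_witness[of _ "\<lambda>k. k - 1" "\<lambda>k. k + 1"]) auto
  also have "\<dots> = (\<Sum>k\<in>{0..L}. f k)"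
    by (rule sum.mono_neutral_right) (auto simp: assms)
  also have "\<dots> = (\<Sum>k\<in>{-1..L + 1}. f k)"
    by (rule sum.mono_neutral_left) (auto simp: assms)
  finally show ?thesis .
qed

text \<open>This is the eigenvalue equation of the Laplacian along the \<open>m\<close>-th diagonal, with eigenvalue
  \<open>- l (l + 1)\<close>, after the square roots have been removed from the matrix entries. In each
  summand the four linear prefactors split into a part in \<open>k\<close> and a part in \<open>i - k\<close>. Absorption uses up the
  parts in \<open>i - k\<close> to bring the binomial \<open>ibinom q\<close> to the argument \<open>i - k\<close>. The remaining products in
  \<open>k\<close> alone, called \<open>P\<close> and \<open>Q\<close> below, turn into each other, with a sign, when \<open>k\<close> is shifted.
  Every term is then a multiple of \<open>a k * b (i - k)\<close>, and the multipliers add up to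
  a number independent of \<open>k\<close>.\<close>

lemma racah_sum_recurrence:
  fixes l q :: nat and m i :: int
  defines "n \<equiv> real (l + q)" and "x \<equiv> real_of_int i" and "\<mu> \<equiv> real_of_int m"
  shows "(n - x + 1) * (n - (x - \<mu>) + 1) * racah_sum l q m (i - 1)
       + (x + 1) * (x - \<mu> + 1) * racah_sum l q m (i + 1)
       = (n * (n + 2) / 2 - 2 * (x - n / 2) * (x - \<mu> - n / 2) - real l * (real l + 1))
         * racah_sum l q m i"
proof -
  define K where "K = {-1..int l + 1}"
  define a where "a = jacobi_coeff l m"
  define b where "b = ibinom q"
  define P where "P k = real_of_int (k * (k - m))" for k
  define Q where "Q k = real_of_int ((int l - k) * (int l - k + m))" for k
  have step: "a (k + 1) * P (k + 1) = - a k * Q k" for k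
    using jacobi_coeff_step[of l m k] unfolding a_def P_def Q_def .
  have a0: "a k = 0" if "k < 0 \<or> int l < k" for k
    using that by (simp add: a_def jacobi_coeff_eq_0)
  have up: "(real_of_int e + 1) * b (e + 1) = (real q - of_int e) * b e" for e
    using ibinom_absorb[of "e + 1" q] by (simp add: b_def)
  have dn: "(real q - of_int e + 1) * b (e - 1) = of_int e * b e" for e
    using ibinom_absorb[of e q] by (simp add: b_def)
  have S1: "(\<Sum>k\<in>K. a k * Q k * b (i - 1 - k)) = - (\<Sum>k\<in>K. a k * P k * b (i - k))"
  proof -
    have "(\<Sum>k\<in>K. a k * Q k * b (i - 1 - k)) = - (\<Sum>k\<in>K. a (k + 1) * P (k + 1) * b (i - (k + 1)))"
      unfolding sum_negf[symmetric] step by (intro sum.cong refl) (simp add: algebra_simps)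
    also have "\<dots> = - (\<Sum>k\<in>K. a k * P k * b (i - k))"
      unfolding K_def by (subst sum_int_shift[of "int l" "\<lambda>k. a k * P k * b (i - k)"]) (simp_all add: a0)
    finally show ?thesis .
  qed
  have S2: "(\<Sum>k\<in>K. a k * P k * b (i + 1 - k)) = - (\<Sum>k\<in>K. a k * Q k * b (i - k))"
  proof -
    have "(\<Sum>k\<in>K. a k * P k * b (i + 1 - k)) = (\<Sum>k\<in>K. a (k + 1) * P (k + 1) * b (i + 1 - (k + 1)))"
      unfolding K_def by (subst sum_int_shift[of "int l" "\<lambda>k. a k * P k * b (i + 1 - k)"]) (simp_all add: a0)
    also have "\<dots> = - (\<Sum>k\<in>K. a k * Q k * b (i - k))"
      unfolding sum_negf[symmetric] by (intro sum.cong refl) (simp add: step)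
    finally show ?thesis .
  qed
  have T1: "(n - x + 1) * (n - (x - \<mu>) + 1) * b (i - 1 - k)
      = Q k * b (i - 1 - k) + ((2 * real l - 2 * of_int k + \<mu>) * (x - of_int k) + (real q - (x - of_int k) + 1) * (x - of_int k)) * b (i - k)" for k :: int
  proof -
    define p where "p = real q - (x - of_int k) + 1"
    have pb: "p * b (i - 1 - k) = (x - of_int k) * b (i - k)"
      using dn[of "i - k"] by (simp add: p_def x_def algebra_simps)
    have "(n - x + 1) * (n - (x - \<mu>) + 1) * b (i - 1 - k)
        = Q k * b (i - 1 - k) + (2 * real l - 2 * of_int k + \<mu>) * (p * b (i - 1 - k)) + p * (p * b (i - 1 - k))"
      by (simp add: Q_def p_def n_def \<mu>_def algebra_simps)
    then show ?thesis unfolding pb unfolding p_def by (simp add: distrib_right mult.assoc)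
  qed
  have T2: "(x + 1) * (x - \<mu> + 1) * b (i + 1 - k)
      = P k * b (i + 1 - k) + ((2 * of_int k - \<mu>) * (real q - (x - of_int k)) + (x - of_int k + 1) * (real q - (x - of_int k))) * b (i - k)" for k :: int
  proof -
    define p where "p = x - of_int k + 1"
    have pb: "p * b (i + 1 - k) = (real q - (x - of_int k)) * b (i - k)"
      using up[of "i - k"] by (simp add: p_def x_def algebra_simps)
    have "(x + 1) * (x - \<mu> + 1) * b (i + 1 - k)
        = P k * b (i + 1 - k) + (2 * of_int k - \<mu>) * (p * b (i + 1 - k)) + p * (p * b (i + 1 - k))"
      by (simp add: P_def p_def \<mu>_def algebra_simps)
    then show ?thesis unfolding pb unfolding p_def by (simp add: distrib_right mult.assoc)
  qed
  have "(n - x + 1) * (n - (x - \<mu>) + 1) * racah_sum l q m (i - 1)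
       + (x + 1) * (x - \<mu> + 1) * racah_sum l q m (i + 1)
     = (\<Sum>k\<in>K. a k * ((n - x + 1) * (n - (x - \<mu>) + 1) * b (i - 1 - k)))
       + (\<Sum>k\<in>K. a k * ((x + 1) * (x - \<mu> + 1) * b (i + 1 - k)))"
    unfolding racah_sum_wide sum_distrib_left a_def b_def K_def by (simp add: mult_ac)
  also have "\<dots> = (\<Sum>k\<in>K. a k * Q k * b (i - 1 - k)) + (\<Sum>k\<in>K. a k * P k * b (i + 1 - k))
     + (\<Sum>k\<in>K. a k * ((2 * real l - 2 * of_int k + \<mu>) * (x - of_int k) + (real q - (x - of_int k) + 1) * (x - of_int k)
            + (2 * of_int k - \<mu>) * (real q - (x - of_int k)) + (x - of_int k + 1) * (real q - (x - of_int k))) * b (i - k))"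
    unfolding T1 T2 sum.distrib[symmetric] by (intro sum.cong refl) (simp add: algebra_simps)
  also have "\<dots> = (\<Sum>k\<in>K. a k * (- P k - Q k + (2 * real l - 2 * of_int k + \<mu>) * (x - of_int k) + (real q - (x - of_int k) + 1) * (x - of_int k)
            + (2 * of_int k - \<mu>) * (real q - (x - of_int k)) + (x - of_int k + 1) * (real q - (x - of_int k))) * b (i - k))"
    unfolding S1 S2 sum_negf[symmetric] sum.distrib[symmetric] by (intro sum.cong refl) (simp add: algebra_simps)
  also have "\<dots> = (\<Sum>k\<in>K. (n * (n + 2) / 2 - 2 * (x - n / 2) * (x - \<mu> - n / 2) - real l * (real l + 1))
         * (a k * b (i - k)))"
  proof (intro sum.cong refl)
    fix k :: int
    have "- P k - Q k + (2 * real l - 2 * of_int k + \<mu>) * (x - of_int k) + (real q - (x - of_int k) + 1) * (x - of_int k)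
            + (2 * of_int k - \<mu>) * (real q - (x - of_int k)) + (x - of_int k + 1) * (real q - (x - of_int k))
       = n * (n + 2) / 2 - 2 * (x - n / 2) * (x - \<mu> - n / 2) - real l * (real l + 1)"
      unfolding P_def Q_def n_def x_def \<mu>_def by (simp add: field_simps)
    then show "a k * (- P k - Q k + (2 * real l - 2 * of_int k + \<mu>) * (x - of_int k) + (real q - (x - of_int k) + 1) * (x - of_int k)
            + (2 * of_int k - \<mu>) * (real q - (x - of_int k)) + (x - of_int k + 1) * (real q - (x - of_int k))) * b (i - k)
       = (n * (n + 2) / 2 - 2 * (x - n / 2) * (x - \<mu> - n / 2) - real l * (real l + 1))
         * (a k * b (i - k))"
      by simp
  qed
  finally show ?thesis
    unfolding racah_sum_wide a_def b_def K_def by (simp add: sum_distrib_left)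
qed

text \<open>At the first entry of the diagonal a single summand survives, which is what shows that the
  tensor operators do not vanish.\<close>

lemma racah_sum_lowest_nonzero:
  assumes "\<bar>m\<bar> \<le> int l"
  shows "racah_sum l q m (max 0 m) \<noteq> 0"
proof -
  let ?p = "max 0 m"
  have "racah_sum l q m ?p = (\<Sum>k\<in>{?p}. jacobi_coeff l m k * ibinom q (?p - k))"
    unfolding racah_sum_def
    by (rule sum.mono_neutral_right) (use assms in \<open>auto simp: jacobi_coeff_def ibinom_def\<close>)
  also have "\<dots> \<noteq> 0"
    using assms by (auto simp: jacobi_coeff_def ibinom_def)
  finally show ?thesis .
qed

text \<open>Outside the matrix the sum vanishes, so the recurrence needs no modification at the two ends of a
  diagonal.\<close>

lemma racah_sum_eq_0:
  assumes "i < 0 \<or> int l + int q < i \<or> i < m \<or> int l + int q + m < i"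
  shows "racah_sum l q m i = 0"
  unfolding racah_sum_def
proof (rule sum.neutral, rule ballI)
  fix k assume "k \<in> {0..int l}"
  then show "jacobi_coeff l m k * ibinom q (i - k) = 0"
    using assms by (cases "0 \<le> k - m \<and> k - m \<le> int l") (auto simp: jacobi_coeff_def ibinom_eq_0)
qed

section \<open>The Laplacian as a double commutator\<close>

text \<open>The matrix element of the raising operator \<open>J\<^sub>+\<close> from index \<open>i\<close> to \<open>i + 1\<close>.\<close>

definition ladder :: "nat \<Rightarrow> nat \<Rightarrow> real" where
  "ladder N i = sqrt ((real i + 1) * (real N - 1 - real i))"

lemma ladder_last: "Suc i = N \<Longrightarrow> ladder N i = 0"
  by (auto simp: ladder_def)

text \<open>The operator \<open>A \<mapsto> - \<Sum>\<^sub>a [J\<^sub>a, [J\<^sub>a, A]]\<close>, expanded as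
  \<open>- 2 s (s + 1) A + 2 J\<^sub>z A J\<^sub>z + J\<^sub>+ A J\<^sub>- + J\<^sub>- A J\<^sub>+\<close> and written entrywise; here \<open>2 s (s + 1) = (N\<^sup>2 - 1) / 2\<close>.\<close>

definition su2_laplacian :: "nat \<Rightarrow> complex mat \<Rightarrow> complex mat" where
  "su2_laplacian N A = mat N N (\<lambda>(i, j).
     complex_of_real (2 * qnum N i * qnum N j - ((real N)\<^sup>2 - 1) / 2) * A $$ (i, j)
     + (if 0 < i \<and> 0 < j then complex_of_real (ladder N (i - 1) * ladder N (j - 1)) * A $$ (i - 1, j - 1) else 0)
     + (if Suc i < N \<and> Suc j < N then complex_of_real (ladder N i * ladder N j) * A $$ (Suc i, Suc j) else 0))"

lemma su2_laplacian_carrier [simp]: "su2_laplacian N A \<in> carrier_mat N N"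
  by (simp add: su2_laplacian_def)

lemma su2_laplacian_dim [simp]:
  "dim_row (su2_laplacian N A) = N" "dim_col (su2_laplacian N A) = N"
  by (simp_all add: su2_laplacian_def)

lemma linear_su2_laplacian: "linear_on_mats N (su2_laplacian N)"
  unfolding linear_on_mats_def
proof (intro conjI ballI allI)
  fix A B :: "complex mat" assume "A \<in> carrier_mat N N" "B \<in> carrier_mat N N"
  then show "su2_laplacian N (A + B) = su2_laplacian N A + su2_laplacian N B"
    by (intro eq_matI) (simp_all add: su2_laplacian_def algebra_simps del: of_real_mult of_real_diff of_real_divide)
next
  fix A :: "complex mat" and c assume "A \<in> carrier_mat N N"
  then show "su2_laplacian N (c \<cdot>\<^sub>m A) = c \<cdot>\<^sub>m su2_laplacian N A"
    by (intro eq_matI) (simp_all add: su2_laplacian_def algebra_simps del: of_real_mult of_real_diff of_real_divide)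
qed simp

lemma su2_laplacian_one: "su2_laplacian N (1\<^sub>m N) = 0\<^sub>m N N"
proof (rule eq_matI)
  fix i j assume "i < dim_row (0\<^sub>m N N :: complex mat)" "j < dim_col (0\<^sub>m N N :: complex mat)"
  then have ij: "i < N" "j < N" by auto
  have sq: "ladder N i * ladder N i = (real i + 1) * (real N - 1 - real i)" if "i < N" for i
    using that by (simp add: ladder_def)
  show "su2_laplacian N (1\<^sub>m N) $$ (i, j) = (0\<^sub>m N N :: complex mat) $$ (i, j)"
  proof (cases "i = j")
    case False
    with ij show ?thesis by (auto simp: su2_laplacian_def)
  next
    case True
    have "(if 0 < i then ladder N (i - 1) * ladder N (i - 1) else 0) = real i * (real N - real i)"
      using sq[of "i - 1"] ij by (auto simp: of_nat_diff)
    moreover have "(if Suc i < N then ladder N i * ladder N i else 0) = (real i + 1) * (real N - 1 - real i)"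
      using sq[of i] ladder_last[of i N] ij by (cases "Suc i = N") auto
    moreover have "2 * qnum N i * qnum N i - ((real N)\<^sup>2 - 1) / 2 + real i * (real N - real i)
        + (real i + 1) * (real N - 1 - real i) = 0"
      by (simp add: qnum_def spin_def field_simps power2_eq_square)
    ultimately have "2 * qnum N i * qnum N i - ((real N)\<^sup>2 - 1) / 2
        + (if 0 < i then ladder N (i - 1) * ladder N (i - 1) else 0)
        + (if Suc i < N then ladder N i * ladder N i else 0) = 0" by simp
    then have "complex_of_real (2 * qnum N i * qnum N i - ((real N)\<^sup>2 - 1) / 2
        + (if 0 < i then ladder N (i - 1) * ladder N (i - 1) else 0)
        + (if Suc i < N then ladder N i * ladder N i else 0)) = 0" by simp
    with True ij show ?thesis by (auto simp: su2_laplacian_def split: if_splits)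
  qed
qed (simp_all add: su2_laplacian_def)

text \<open>The pairing is bilinear rather than Hermitian, which suffices for orthogonality because the tensor
  operators have real entries.\<close>

definition pairing :: "nat \<Rightarrow> complex mat \<Rightarrow> complex mat \<Rightarrow> complex" where
  "pairing N A B = (\<Sum>p\<in>{..<N} \<times> {..<N}. A $$ p * B $$ p)"

lemma pairing_one: "A \<in> carrier_mat N N \<Longrightarrow> pairing N A (1\<^sub>m N) = mtrace A"
proof -
  assume A: "A \<in> carrier_mat N N"
  have "pairing N A (1\<^sub>m N) = (\<Sum>i<N. \<Sum>j<N. A $$ (i, j) * 1\<^sub>m N $$ (i, j))"
    unfolding pairing_def sum.cartesian_product by (simp only: split_def prod.collapse)
  also have "\<dots> = (\<Sum>i<N. \<Sum>j<N. if i = j then A $$ (i, j) else 0)"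
    by (intro sum.cong refl) auto
  also have "\<dots> = mtrace A" using A by (simp add: mtrace_def)
  finally show ?thesis .
qed

text \<open>Symmetry holds because the couplings to the two neighbours on a diagonal are transposes of each
  other.\<close>

lemma su2_laplacian_selfadjoint: "pairing N (su2_laplacian N A) B = pairing N A (su2_laplacian N B)"
proof -
  let ?P = "{..<N} \<times> {..<N}"
  define L where "L A p = (case p of (i, j) \<Rightarrow> if 0 < i \<and> 0 < j
     then complex_of_real (ladder N (i - 1) * ladder N (j - 1)) * A $$ (i - 1, j - 1) else 0)" for A :: "complex mat" and p
  define R where "R A p = (case p of (i, j) \<Rightarrow> if Suc i < N \<and> Suc j < N
     then complex_of_real (ladder N i * ladder N j) * A $$ (Suc i, Suc j) else 0)" for A :: "complex mat" and p
  define d where "d p = (case p of (i, j) \<Rightarrow>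
     complex_of_real (2 * qnum N i * qnum N j - ((real N)\<^sup>2 - 1) / 2))" for p
  have lap: "su2_laplacian N A $$ p = d p * A $$ p + L A p + R A p" if "p \<in> ?P" for A p
    using that by (auto simp: su2_laplacian_def L_def R_def d_def)
  have shift: "(\<Sum>p\<in>?P. L A p * B $$ p) = (\<Sum>p\<in>?P. A $$ p * R B p)" for A B
  proof -
    have "(\<Sum>p\<in>?P. L A p * B $$ p) = (\<Sum>(i, j)\<in>{1..<N} \<times> {1..<N}.
        complex_of_real (ladder N (i - 1) * ladder N (j - 1)) * A $$ (i - 1, j - 1) * B $$ (i, j))"
      by (rule sum.mono_neutral_cong_right) (auto simp: L_def split: if_splits)
    also have "\<dots> = (\<Sum>(i, j)\<in>{..<N - 1} \<times> {..<N - 1}.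
        A $$ (i, j) * (complex_of_real (ladder N i * ladder N j) * B $$ (Suc i, Suc j)))"
      by (rule sum.reindex_bij_witness[of _ "\<lambda>(i, j). (Suc i, Suc j)" "\<lambda>(i, j). (i - 1, j - 1)"]) auto
    also have "\<dots> = (\<Sum>p\<in>?P. A $$ p * R B p)"
      by (rule sum.mono_neutral_cong_left) (auto simp: R_def split: if_splits)
    finally show ?thesis .
  qed
  have "pairing N (su2_laplacian N A) B
      = (\<Sum>p\<in>?P. d p * A $$ p * B $$ p) + (\<Sum>p\<in>?P. L A p * B $$ p) + (\<Sum>p\<in>?P. R A p * B $$ p)"
    unfolding pairing_def sum.distrib[symmetric]
    by (intro sum.cong refl) (simp add: lap algebra_simps)
  also have "(\<Sum>p\<in>?P. R A p * B $$ p) = (\<Sum>p\<in>?P. A $$ p * L B p)"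
    using shift[of B A] by (simp add: mult.commute)
  also have "(\<Sum>p\<in>?P. L A p * B $$ p) = (\<Sum>p\<in>?P. A $$ p * R B p)" by (rule shift)
  also have "(\<Sum>p\<in>?P. d p * A $$ p * B $$ p) + (\<Sum>p\<in>?P. A $$ p * R B p) + (\<Sum>p\<in>?P. A $$ p * L B p)
      = pairing N A (su2_laplacian N B)"
    unfolding pairing_def sum.distrib[symmetric]
    by (intro sum.cong refl) (simp add: lap algebra_simps)
  finally show ?thesis .
qed

lemma pairing_smult:
  "A \<in> carrier_mat N N \<Longrightarrow> pairing N (c \<cdot>\<^sub>m A) B = c * pairing N A B"
  "B \<in> carrier_mat N N \<Longrightarrow> pairing N A (c \<cdot>\<^sub>m B) = c * pairing N A B"
  unfolding pairing_def sum_distrib_left by (auto intro!: sum.cong)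

section \<open>The tensor operators are eigenvectors\<close>

lemma nfact_of_int: "nfact (real_of_int z) = fact (nat z)"
  by (simp add: nfact_def)

text \<open>The part of Racah's square root that depends on the position inside the matrix.\<close>

definition racah_weight :: "nat \<Rightarrow> nat \<Rightarrow> real" where
  "racah_weight N i = sqrt (fact i * fact (N - 1 - i))"

lemma racah_weight_nonzero: "racah_weight N i \<noteq> 0"
  by (simp add: racah_weight_def)

lemma ibinom_conv_fact:
  "0 \<le> d \<Longrightarrow> d \<le> int q \<Longrightarrow> ibinom q d = fact q / (fact (nat d) * fact (nat (int q - d)))"
  using binomial_fact[of "nat d" q, where 'a = real] by (auto simp: ibinom_def nat_diff_distrib)

lemma racah_sum_conv_factorials:
  assumes "l \<le> n" and "i \<le> n"
  shows "(\<Sum>k | int k \<le> int l \<and> int k \<le> int i \<and> int k \<le> int l + m \<and> int l - int n + int i \<le> int k \<and> m \<le> int k.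
       (-1) ^ k / (fact k * fact (nat (int n - int l - int i + int k)) * fact (nat (int k - m))
         * fact (nat (int l - int k)) * fact (nat (int i - int k)) * fact (nat (int l + m - int k))))
     = racah_sum l (n - l) m (int i) / (fact l * fact l * fact (n - l))"
    (is "(\<Sum>k\<in>?S. ?f k) = _")
proof -
  have "racah_sum l (n - l) m (int i) = (\<Sum>k\<in>{..l}. jacobi_coeff l m (int k) * ibinom (n - l) (int i - int k))"
    unfolding racah_sum_def
    by (rule sum.reindex_bij_witness[of _ int nat]) auto
  also have "\<dots> = (\<Sum>k\<in>?S. jacobi_coeff l m (int k) * ibinom (n - l) (int i - int k))"
  proof (rule sum.mono_neutral_right)
    show "\<forall>k\<in>{..l} - ?S. jacobi_coeff l m (int k) * ibinom (n - l) (int i - int k) = 0"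
      using assms by (auto simp: jacobi_coeff_def not_le of_nat_diff intro!: ibinom_eq_0)
  qed auto
  also have "\<dots> = (\<Sum>k\<in>?S. ?f k * (fact l * fact l * fact (n - l)))"
  proof (intro sum.cong refl)
    fix k assume "k \<in> ?S"
    then have k: "int k \<le> int l" "int k \<le> int i" "int k \<le> int l + m"
      "int l - int n + int i \<le> int k" "m \<le> int k" by auto
    have b1: "ibinom l (int k) = fact l / (fact k * fact (nat (int l - int k)))"
      using ibinom_conv_fact[of "int k" l] k by simp
    have b2: "ibinom l (int k - m) = fact l / (fact (nat (int k - m)) * fact (nat (int l + m - int k)))"
      using ibinom_conv_fact[of "int k - m" l] k by (simp add: algebra_simps)
    have b3: "ibinom (n - l) (int i - int k)
        = fact (n - l) / (fact (nat (int i - int k)) * fact (nat (int n - int l - int i + int k)))"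
      using ibinom_conv_fact[of "int i - int k" "n - l"] k assms by (simp add: of_nat_diff algebra_simps)
    show "jacobi_coeff l m (int k) * ibinom (n - l) (int i - int k) = ?f k * (fact l * fact l * fact (n - l))"
      unfolding jacobi_coeff_def b1 b2 b3 by (simp add: mult_ac)
  qed
  also have "\<dots> = (\<Sum>k\<in>?S. ?f k) * (fact l * fact l * fact (n - l))"
    by (rule sum_distrib_right[symmetric])
  finally show ?thesis
    by (subst nonzero_eq_divide_eq) (simp_all only: fact_nonzero mult_eq_0_iff de_Morgan_disj, simp)
qed

lemma T_basis_off_diagonal:
  assumes "i < N" "j < N" "int i \<noteq> int j + m"
  shows "T_basis N l m $$ (i, j) = 0"
proof -
  have "real_of_int (- int i + m + int j) \<noteq> 0"
    using assms by simp
  then have "- qnum N i + real_of_int m + qnum N j \<noteq> 0"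
    by (simp add: qnum_def)
  then show ?thesis using assms by (simp add: T_basis_def wigner3j_def Let_def)
qed

lemma T_basis_carrier [simp]: "T_basis N l m \<in> carrier_mat N N"
  by (simp add: T_basis_def)

lemma T_basis_dim [simp]: "dim_row (T_basis N l m) = N" "dim_col (T_basis N l m) = N"
  by (simp_all add: T_basis_def)

text \<open>On its diagonal a tensor operator is, up to one nonzero constant, \<open>racah_sum\<close> times the weights of
  row and column. The two position-dependent signs, one from the definition of the tensor operator and
  one from the 3j-symbol, combine to the constant \<open>(-1)\<^bsup>l + m\<^esup>\<close>.\<close>

lemma T_basis_entry:
  assumes N: "1 \<le> N" and l: "l \<le> N - 1" and m: "\<bar>m\<bar> \<le> int l"
  obtains \<kappa> :: real where "\<kappa> \<noteq> 0"
    and "\<And>i j. i < N \<Longrightarrow> j < N \<Longrightarrow> int i = int j + m \<Longrightarrow> T_basis N l m $$ (i, j)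
        = complex_of_real (\<kappa> * racah_weight N i * racah_weight N j * racah_sum l (N - 1 - l) m (int i))"
proof -
  define n where "n = N - 1"
  have Nn: "N = Suc n" using N by (simp add: n_def)
  define c1 where "c1 = sqrt (real N / (4 * pi)) * sqrt (2 * real l + 1)"
  define c2 where "c2 = sqrt (fact l * fact (n - l) * fact l / fact (n + l + 1) :: real)"
  define c3 where "c3 = sqrt (fact (nat (int l - m)) * fact (nat (int l + m)) :: real)"
  define sg where "sg = (-1::real) powi (int l + m)"
  define \<kappa> where "\<kappa> = sg * c1 * c2 * c3 / (fact l * fact l * fact (n - l))"
  have "\<kappa> \<noteq> 0"
    using Nn by (simp add: \<kappa>_def c1_def c2_def c3_def sg_def add_nonneg_eq_0_iff)
  moreover have "T_basis N l m $$ (i, j)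
        = complex_of_real (\<kappa> * racah_weight N i * racah_weight N j * racah_sum l (N - 1 - l) m (int i))"
    if i: "i < N" and j: "j < N" and ij: "int i = int j + m" for i j
  proof -
    have il: "i \<le> n" "j \<le> n" "l \<le> n" using i j l by (auto simp: n_def)
    define s where "s = spin N"
    define M1 where "M1 = - qnum N i"
    define M3 where "M3 = qnum N j"
    have s2: "2 * s = real n" by (simp add: s_def spin_def Nn)
    have a1: "s + real l - s = of_int (int l)" "s - real l + s = of_int (int n - int l)"
      "- s + real l + s = of_int (int l)" "s + real l + s + 1 = of_int (int n + int l + 1)"
      "s - M1 = of_int (int i)" "s + M1 = of_int (int n - int i)"
      "real l - of_int m = of_int (int l - m)" "real l + of_int m = of_int (int l + m)"
      "s - M3 = of_int (int n - int j)" "s + M3 = of_int (int j)"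
      "real l - s - M1 = of_int (int l - int n + int i)" "s - s + of_int m = of_int m"
      "s - real l - M3 = of_int (int n - int l - int j)"
      using s2 by (simp_all add: M1_def M3_def qnum_def s_def[symmetric])
    have a2: "s - real l + M1 + real k = of_int (int n - int l - int i + int k)"
      "s - s - of_int m + real k = of_int (int k - m)"
      "s + real l - s - real k = of_int (int l - int k)"
      "s - M1 - real k = of_int (int i - int k)"
      "real l + of_int m - real k = of_int (int l + m - int k)" for k
      using s2 by (simp_all add: M1_def M3_def qnum_def s_def[symmetric])
    have sel: "M1 + of_int m + M3 = 0 \<and> \<bar>s - real l\<bar> \<le> s \<and> s \<le> s + real l \<and> s + real l + s \<in> \<int> \<and>
        (\<forall>(j, m) \<in> {(s, M1), (real l, of_int m), (s, M3)}. \<bar>m\<bar> \<le> j \<and> j - m \<in> \<int> \<and> j + m \<in> \<int>)"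
    proof -
      have "M1 + of_int m + M3 = of_int (- int i + m + int j)"
        by (simp add: M1_def M3_def qnum_def)
      then have "M1 + of_int m + M3 = 0" using ij by simp
      moreover have "\<bar>s - real l\<bar> \<le> s" using il s2 by linarith
      moreover have "s + real l + s = of_int (int n + int l)" using s2 by simp
      then have "s + real l + s \<in> \<int>" by (metis Ints_of_int)
      moreover have "\<bar>M1\<bar> \<le> s" "\<bar>M3\<bar> \<le> s"
        using il s2 by (auto simp: M1_def M3_def qnum_def s_def[symmetric] abs_if)
      moreover have "\<bar>real_of_int m\<bar> \<le> real l" using m by linarith
      ultimately show ?thesis by (auto simp: a1)
    qed
    have w: "wigner3j s (real l) s M1 (of_int m) M3 = (-1) powi (int n - int l - int j)
        * c2 * (racah_weight N i * c3 * racah_weight N j)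
        * (racah_sum l (n - l) m (int i) / (fact l * fact l * fact (n - l)))"
    proof -
      have root: "sqrt (fact (nat (int i)) * fact (nat (int n - int i)) * fact (nat (int l - m)) * fact (nat (int l + m))
            * fact (nat (int n - int j)) * fact (nat (int j)))
          = racah_weight N i * c3 * racah_weight N j"
        using il by (simp add: racah_weight_def c3_def Nn real_sqrt_mult[symmetric] nat_diff_distrib mult_ac)
      have c2': "sqrt (fact (nat (int l)) * fact (nat (int n - int l)) * fact (nat (int l)) / fact (nat (int n + int l + 1))) = c2"
        using il by (simp add: c2_def nat_diff_distrib nat_add_distrib)
      have le: "real k \<le> of_int z \<longleftrightarrow> int k \<le> z" "of_int z \<le> real k \<longleftrightarrow> z \<le> int k" for k z
        by linarith+
      show ?thesis
        unfolding wigner3j_def if_P[OF sel] unfolding a2 unfolding a1 nfact_of_int floor_of_int le root c2'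
          racah_sum_conv_factorials[OF il(3) il(1)]
        by (simp add: conj_ac)
    qed
    have sg: "(-1::real) powi (int n - int i) * (-1) powi (int n - int l - int j) = sg"
    proof -
      have "(-1::real) powi (int n - int i) * (-1) powi (int n - int l - int j)
          = (-1) powi ((int n - int i) + (int n - int l - int j))"
        by (rule power_int_add[symmetric]) simp
      also have "\<dots> = sg"
        unfolding sg_def power_int_minus_left using ij by (auto simp: algebra_simps)
      finally show ?thesis .
    qed
    have "T_basis N l m $$ (i, j) = complex_of_real
       (sqrt (real N / (4 * pi)) * (-1) powi \<lfloor>s - qnum N i\<rfloor> * sqrt (2 * real l + 1)
        * wigner3j s (real l) s M1 (of_int m) M3)"
      using i j by (simp add: T_basis_def Let_def s_def M1_def M3_def)
    also have "s - qnum N i = of_int (int n - int i)" using a1(6) by (simp add: M1_def)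
    also have "sqrt (real N / (4 * pi)) * (-1) powi \<lfloor>real_of_int (int n - int i)\<rfloor> * sqrt (2 * real l + 1)
        * wigner3j s (real l) s M1 (of_int m) M3
       = sg * c1 * c2 * c3
          / (fact l * fact l * fact (n - l))
          * racah_weight N i * racah_weight N j * racah_sum l (n - l) m (int i)"
      unfolding w floor_of_int c1_def sg[symmetric] by (simp add: mult_ac)
    finally show ?thesis by (simp add: \<kappa>_def n_def)
  qed
  ultimately show ?thesis by (rule that)
qed

text \<open>Factoring out the weights of row and column clears the square roots: it turns the matrix
  elements of \<open>J\<^sub>+\<close> and \<open>J\<^sub>-\<close> into the polynomial factors of \<open>racah_sum_recurrence\<close>.\<close>

lemma ladder_weight:
  assumes "Suc i < N"
  shows "ladder N i * racah_weight N (Suc i) = (real i + 1) * racah_weight N i"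
    and "ladder N i * racah_weight N i = (real N - 1 - real i) * racah_weight N (Suc i)"
proof -
  obtain d where d: "N = Suc (Suc (i + d))"
    using assms less_imp_Suc_add by blast
  have h: "ladder N i = sqrt (real (Suc i)) * sqrt (real (Suc d))"
    by (simp add: ladder_def d real_sqrt_mult add.commute)
  have w: "racah_weight N i = sqrt (fact i) * (sqrt (real (Suc d)) * sqrt (fact d))"
    by (simp add: racah_weight_def d real_sqrt_mult)
  have w': "racah_weight N (Suc i) = sqrt (real (Suc i)) * sqrt (fact i) * sqrt (fact d)"
    by (simp add: racah_weight_def d real_sqrt_mult)
  have a: "real i + 1 = sqrt (real (Suc i)) * sqrt (real (Suc i))"
    and b: "real N - 1 - real i = sqrt (real (Suc d)) * sqrt (real (Suc d))"
    by (simp_all add: d)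
  show "ladder N i * racah_weight N (Suc i) = (real i + 1) * racah_weight N i"
    and "ladder N i * racah_weight N i = (real N - 1 - real i) * racah_weight N (Suc i)"
    unfolding h w w' a b by (simp_all only: mult_ac)
qed

lemma T_basis_eigen:
  assumes N: "1 \<le> N" and l: "l \<le> N - 1" and m: "\<bar>m\<bar> \<le> int l"
  shows "su2_laplacian N (T_basis N l m) = (- of_nat (l * (l + 1))) \<cdot>\<^sub>m T_basis N l m"
proof (rule eq_matI)
  let ?T = "T_basis N l m"
  obtain \<kappa> where T: "\<And>i j. i < N \<Longrightarrow> j < N \<Longrightarrow> int i = int j + m \<Longrightarrow> ?T $$ (i, j)
        = complex_of_real (\<kappa> * racah_weight N i * racah_weight N j * racah_sum l (N - 1 - l) m (int i))"
    using T_basis_entry[OF N l m] by metis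
  note off = T_basis_off_diagonal[of _ N _ m l]
  fix i j assume "i < dim_row ((- of_nat (l * (l + 1))) \<cdot>\<^sub>m ?T)" "j < dim_col ((- of_nat (l * (l + 1))) \<cdot>\<^sub>m ?T)"
  then have i: "i < N" and j: "j < N" using T_basis_carrier[of N l m] by auto
  show "su2_laplacian N ?T $$ (i, j) = ((- of_nat (l * (l + 1))) \<cdot>\<^sub>m ?T) $$ (i, j)"
  proof (cases "int i = int j + m")
    case False
    then show ?thesis using i j T_basis_carrier[of N l m] by (auto simp: su2_laplacian_def off of_nat_diff)
  next
    case True
    define w where "w = racah_sum l (N - 1 - l) m"
    define g where "g = \<kappa> * racah_weight N i * racah_weight N j"
    have wz: "w z = 0" if "z < 0 \<or> int N - 1 < z \<or> z < m \<or> int N - 1 + m < z" for z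
      using that l N by (auto simp: w_def intro!: racah_sum_eq_0)
    have low: "(if 0 < i \<and> 0 < j then complex_of_real (ladder N (i - 1) * ladder N (j - 1)) * ?T $$ (i - 1, j - 1) else 0)
       = complex_of_real (g * ((real N - real i) * (real N - real j) * w (int i - 1)))"
    proof (cases "0 < i \<and> 0 < j")
      case False
      then have "w (int i - 1) = 0" using True by (intro wz) auto
      with False show ?thesis by auto
    next
      case pos: True
      have "?T $$ (i - 1, j - 1) = complex_of_real (\<kappa> * racah_weight N (i - 1) * racah_weight N (j - 1) * w (int i - 1))"
        using T[of "i - 1" "j - 1"] pos i j True by (simp add: w_def of_nat_diff)
      then have "complex_of_real (ladder N (i - 1) * ladder N (j - 1)) * ?T $$ (i - 1, j - 1)
         = complex_of_real (\<kappa> * (ladder N (i - 1) * racah_weight N (i - 1)) * (ladder N (j - 1) * racah_weight N (j - 1)) * w (int i - 1))"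
        by simp
      also have "\<dots> = complex_of_real (g * ((real N - real i) * (real N - real j) * w (int i - 1)))"
        using ladder_weight(2)[of "i - 1" N] ladder_weight(2)[of "j - 1" N] pos i j
        by (simp add: g_def of_nat_diff)
      finally show ?thesis using pos by simp
    qed
    have high: "(if Suc i < N \<and> Suc j < N then complex_of_real (ladder N i * ladder N j) * ?T $$ (Suc i, Suc j) else 0)
       = complex_of_real (g * ((real i + 1) * (real j + 1) * w (int i + 1)))"
    proof (cases "Suc i < N \<and> Suc j < N")
      case False
      then have "w (int i + 1) = 0" using True i j by (intro wz) auto
      with False show ?thesis by auto
    next
      case pos: True
      have "?T $$ (Suc i, Suc j) = complex_of_real (\<kappa> * racah_weight N (Suc i) * racah_weight N (Suc j) * w (int i + 1))"
        using T[of "Suc i" "Suc j"] pos True by (simp add: w_def add.commute)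
      then have "complex_of_real (ladder N i * ladder N j) * ?T $$ (Suc i, Suc j)
         = complex_of_real (\<kappa> * (ladder N i * racah_weight N (Suc i)) * (ladder N j * racah_weight N (Suc j)) * w (int i + 1))"
        by simp
      also have "\<dots> = complex_of_real (g * ((real i + 1) * (real j + 1) * w (int i + 1)))"
        using ladder_weight(1)[of i N] ladder_weight(1)[of j N] pos by (simp add: g_def)
      finally show ?thesis using pos by simp
    qed
    have mid: "?T $$ (i, j) = complex_of_real (g * w (int i))"
      using T[OF i j True] by (simp add: g_def w_def)
    have m': "real_of_int m = real i - real j" using True by linarith
    have rec: "(real N - real i) * (real N - real j) * w (int i - 1) + (real i + 1) * (real j + 1) * w (int i + 1)
       = (((real N)\<^sup>2 - 1) / 2 - 2 * qnum N i * qnum N j - real l * (real l + 1)) * w (int i)"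
      using racah_sum_recurrence[of l "N - 1 - l" "int i" m] l N
      by (simp add: w_def m' qnum_def spin_def field_simps power2_eq_square)
    have "su2_laplacian N ?T $$ (i, j) = complex_of_real ((2 * qnum N i * qnum N j - ((real N)\<^sup>2 - 1) / 2) * (g * w (int i))
        + g * ((real N - real i) * (real N - real j) * w (int i - 1)) + g * ((real i + 1) * (real j + 1) * w (int i + 1)))"
      using i j by (simp add: su2_laplacian_def low high mid)
    also have "\<dots> = complex_of_real ((2 * qnum N i * qnum N j - ((real N)\<^sup>2 - 1) / 2) * (g * w (int i))
        + g * ((real N - real i) * (real N - real j) * w (int i - 1) + (real i + 1) * (real j + 1) * w (int i + 1)))"
      by (simp add: algebra_simps)
    also have "\<dots> = complex_of_real (- (real l * (real l + 1)) * (g * w (int i)))"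
      unfolding rec by (simp add: algebra_simps)
    also have "\<dots> = ((- of_nat (l * (l + 1))) \<cdot>\<^sub>m ?T) $$ (i, j)"
      using i j by (simp add: mid algebra_simps)
    finally show ?thesis .
  qed
qed (use T_basis_carrier[of N l m] in \<open>auto simp: su2_laplacian_def\<close>)

lemma T_basis_real: "i < N \<Longrightarrow> j < N \<Longrightarrow> T_basis N l m $$ (i, j) \<in> \<real>"
  by (simp add: T_basis_def Let_def del: of_real_mult)

lemma T_basis_norm_nonzero:
  assumes N: "1 \<le> N" and l: "l \<le> N - 1" and m: "\<bar>m\<bar> \<le> int l"
  shows "pairing N (T_basis N l m) (T_basis N l m) \<noteq> 0"
proof
  let ?T = "T_basis N l m"
  let ?P = "{..<N} \<times> {..<N}"
  assume 0: "pairing N ?T ?T = 0"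
  have sq: "?T $$ p * ?T $$ p = complex_of_real ((Re (?T $$ p))\<^sup>2)" if "p \<in> ?P" for p
    using that T_basis_real[of "fst p" N "snd p" l m]
    by (auto simp: complex_is_Real_iff complex_eq_iff power2_eq_square split: prod.splits)
  have "complex_of_real (\<Sum>p\<in>?P. (Re (?T $$ p))\<^sup>2) = 0"
    using 0 unfolding pairing_def by (simp add: sq)
  then have "(\<Sum>p\<in>?P. (Re (?T $$ p))\<^sup>2) = 0" by (simp only: of_real_eq_0_iff)
  then have z: "\<And>p. p \<in> ?P \<Longrightarrow> Re (?T $$ p) = 0"
    by (subst (asm) sum_nonneg_eq_0_iff) auto
  obtain \<kappa> where \<kappa>: "\<kappa> \<noteq> 0" and T: "\<And>i j. i < N \<Longrightarrow> j < N \<Longrightarrow> int i = int j + m \<Longrightarrow> ?T $$ (i, j)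
        = complex_of_real (\<kappa> * racah_weight N i * racah_weight N j * racah_sum l (N - 1 - l) m (int i))"
    using T_basis_entry[OF N l m] by metis
  define i where "i = nat (max 0 m)"
  define j where "j = nat (max 0 m - m)"
  have ij: "i < N" "j < N" "int i = int j + m" "int i = max 0 m"
    using N l m by (auto simp: i_def j_def)
  have "Re (?T $$ (i, j)) = \<kappa> * racah_weight N i * racah_weight N j * racah_sum l (N - 1 - l) m (max 0 m)"
    using T[OF ij(1-3)] ij(4) by simp
  also have "\<dots> \<noteq> 0"
    using \<kappa> racah_weight_nonzero racah_sum_lowest_nonzero[OF m] by simp
  finally show False using z[of "(i, j)"] ij by simp
qed

text \<open>For \<open>m \<noteq> m'\<close> the supports are disjoint; for \<open>l \<noteq> l'\<close> the eigenvalues of a symmetric operator differ.\<close>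

lemma T_basis_orthogonal:
  assumes N: "1 \<le> N" and l: "l \<le> N - 1" and m: "\<bar>m\<bar> \<le> int l"
    and l': "l' \<le> N - 1" and m': "\<bar>m'\<bar> \<le> int l'" and ne: "(l, m) \<noteq> (l', m')"
  shows "pairing N (T_basis N l m) (T_basis N l' m') = 0"
proof (cases "m = m'")
  case False
  then show ?thesis
    unfolding pairing_def
    by (intro sum.neutral) (auto, metis T_basis_off_diagonal add_left_cancel)
next
  case True
  with ne have "l \<noteq> l'" by simp
  then have "l * (l + 1) \<noteq> l' * (l' + 1)"
    by (metis add_less_mono1 linorder_neqE_nat mult_strict_mono' nat_less_le zero_le)
  then have "complex_of_nat (l * (l + 1)) \<noteq> of_nat (l' * (l' + 1))" by (simp only: of_nat_eq_iff) simp
  moreover have "- of_nat (l * (l + 1)) * pairing N (T_basis N l m) (T_basis N l' m')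
      = - of_nat (l' * (l' + 1)) * pairing N (T_basis N l m) (T_basis N l' m')"
    using su2_laplacian_selfadjoint[of N "T_basis N l m" "T_basis N l' m'"]
    unfolding T_basis_eigen[OF N l m] T_basis_eigen[OF N l' m']
    by (simp only: pairing_smult T_basis_carrier)
  ultimately show ?thesis by (metis minus_equation_iff mult_cancel_right)
qed

section \<open>Completeness and the inverse Laplacian\<close>

text \<open>Orthogonality says that the square matrix of the family has a right inverse, its transpose with
  rescaled columns. A right inverse of a square matrix is also a left inverse, and this is completeness.\<close>

lemma orthogonal_family_expansion:
  fixes T :: "'a \<Rightarrow> 'b \<Rightarrow> complex"
  assumes I: "finite I" and K: "finite K" and card: "card I = card K"
    and orth: "\<And>a b. a \<in> I \<Longrightarrow> b \<in> I \<Longrightarrow> a \<noteq> b \<Longrightarrow> (\<Sum>k\<in>K. T a k * T b k) = 0"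
    and norm: "\<And>a. a \<in> I \<Longrightarrow> (\<Sum>k\<in>K. T a k * T a k) \<noteq> 0"
    and k: "k \<in> K"
  shows "f k = (\<Sum>a\<in>I. (\<Sum>k'\<in>K. f k' * T a k') / (\<Sum>k'\<in>K. T a k' * T a k') * T a k)"
proof -
  define d where "d a = (\<Sum>k\<in>K. T a k * T a k)" for a
  define n where "n = card K"
  obtain \<alpha> where \<alpha>: "bij_betw \<alpha> {..<n} I"
    using ex_bij_betw_nat_finite[OF I] card by (auto simp: n_def lessThan_atLeast0)
  obtain \<beta> where \<beta>: "bij_betw \<beta> {..<n} K"
    using ex_bij_betw_nat_finite[OF K] by (auto simp: n_def lessThan_atLeast0)
  have \<alpha>I: "\<alpha> r \<in> I" if "r < n" for r using \<alpha> that by (auto simp: bij_betw_def)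
  define M where "M = mat n n (\<lambda>(r, c). T (\<alpha> r) (\<beta> c))"
  define M' where "M' = mat n n (\<lambda>(c, r). T (\<alpha> r) (\<beta> c) / d (\<alpha> r))"
  have M: "M \<in> carrier_mat n n" "M' \<in> carrier_mat n n" by (auto simp: M_def M'_def)
  have "M * M' = 1\<^sub>m n"
  proof (rule eq_matI)
    fix r s assume "r < dim_row (1\<^sub>m n :: complex mat)" "s < dim_col (1\<^sub>m n :: complex mat)"
    then have rs: "r < n" "s < n" by auto
    have "(M * M') $$ (r, s) = (\<Sum>c<n. T (\<alpha> r) (\<beta> c) * T (\<alpha> s) (\<beta> c) / d (\<alpha> s))"
      using rs by (simp add: M_def M'_def scalar_prod_def lessThan_atLeast0)
    also have "\<dots> = (\<Sum>k\<in>K. T (\<alpha> r) k * T (\<alpha> s) k) / d (\<alpha> s)"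
      using sum.reindex_bij_betw[OF \<beta>, of "\<lambda>k. T (\<alpha> r) k * T (\<alpha> s) k / d (\<alpha> s)"]
      by (simp add: sum_divide_distrib)
    also have "\<dots> = 1\<^sub>m n $$ (r, s)"
    proof (cases "r = s")
      case True
      then show ?thesis using norm[OF \<alpha>I[OF rs(1)]] rs by (simp add: d_def)
    next
      case False
      then have "\<alpha> r \<noteq> \<alpha> s" using \<alpha> rs by (auto simp: bij_betw_def inj_on_def)
      then show ?thesis using orth \<alpha>I rs False by simp
    qed
    finally show "(M * M') $$ (r, s) = 1\<^sub>m n $$ (r, s)" .
  qed (use M in auto)
  then have inv: "M' * M = 1\<^sub>m n" by (rule mat_mult_left_right_inverse[OF M])
  have compl: "(\<Sum>a\<in>I. T a x / d a * T a y) = (if x = y then 1 else 0)" if x: "x \<in> K" and y: "y \<in> K" for x y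
  proof -
    obtain c c' where c: "c < n" "x = \<beta> c" "c' < n" "y = \<beta> c'"
      using \<beta> x y by (auto simp: bij_betw_def)
    have "(\<Sum>a\<in>I. T a x / d a * T a y) = (\<Sum>r<n. T (\<alpha> r) x / d (\<alpha> r) * T (\<alpha> r) y)"
      by (rule sum.reindex_bij_betw[OF \<alpha>, symmetric])
    also have "\<dots> = (M' * M) $$ (c, c')"
      using c by (simp add: M_def M'_def scalar_prod_def lessThan_atLeast0)
    also have "\<dots> = (if x = y then 1 else 0)"
      using c \<beta> by (auto simp: inv bij_betw_def inj_on_def)
    finally show ?thesis .
  qed
  have "(\<Sum>a\<in>I. (\<Sum>k'\<in>K. f k' * T a k') / d a * T a k) = (\<Sum>a\<in>I. \<Sum>k'\<in>K. f k' * (T a k' / d a * T a k))"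
    by (simp add: sum_distrib_right sum_divide_distrib mult.assoc)
  also have "\<dots> = (\<Sum>k'\<in>K. f k' * (\<Sum>a\<in>I. T a k' / d a * T a k))"
    by (subst sum.swap) (simp add: sum_distrib_left)
  also have "\<dots> = (\<Sum>k'\<in>K. f k' * (if k' = k then 1 else 0))"
    using k by (intro sum.cong refl) (simp only: compl)
  also have "\<dots> = f k" using k K by (simp add: if_distrib cong: if_cong)
  finally show ?thesis by (simp add: d_def)
qed

definition modes :: "nat \<Rightarrow> (nat \<times> int) set" where
  "modes N = (SIGMA l:{..<N}. {- int l..int l})"

lemma modesD: "a \<in> modes N \<Longrightarrow> fst a \<le> N - 1" "a \<in> modes N \<Longrightarrow> \<bar>snd a\<bar> \<le> int (fst a)"
  by (auto simp: modes_def)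

lemma finite_modes [simp]: "finite (modes N)"
  by (simp add: modes_def)

lemma card_modes: "card (modes N) = N * N"
proof -
  have "card (modes N) = (\<Sum>l<N. nat (2 * int l + 1))"
    by (simp add: modes_def algebra_simps)
  also have "\<dots> = N * N"
    by (induction N) (auto simp: nat_add_distrib nat_mult_distrib)
  finally show ?thesis .
qed

lemma T_basis_expansion:
  assumes N: "1 \<le> N" and p: "p \<in> {..<N} \<times> {..<N}"
  shows "A $$ p = (\<Sum>(l, m)\<in>modes N. pairing N A (T_basis N l m)
           / pairing N (T_basis N l m) (T_basis N l m) * T_basis N l m $$ p)"
proof -
  have "A $$ p = (\<Sum>a\<in>modes N. (\<Sum>q\<in>{..<N} \<times> {..<N}. A $$ q * T_basis N (fst a) (snd a) $$ q)
      / (\<Sum>q\<in>{..<N} \<times> {..<N}. T_basis N (fst a) (snd a) $$ q * T_basis N (fst a) (snd a) $$ q)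
      * T_basis N (fst a) (snd a) $$ p)"
  proof (rule orthogonal_family_expansion)
    show "card (modes N) = card ({..<N} \<times> {..<N})" by (simp add: card_modes)
  next
    fix a b assume "a \<in> modes N" "b \<in> modes N" "a \<noteq> b"
    then show "(\<Sum>q\<in>{..<N} \<times> {..<N}. T_basis N (fst a) (snd a) $$ q * T_basis N (fst b) (snd b) $$ q) = 0"
      unfolding pairing_def[symmetric] by (intro T_basis_orthogonal N modesD) simp_all
  next
    fix a assume "a \<in> modes N"
    then show "(\<Sum>q\<in>{..<N} \<times> {..<N}. T_basis N (fst a) (snd a) $$ q * T_basis N (fst a) (snd a) $$ q) \<noteq> 0"
      unfolding pairing_def[symmetric] by (intro T_basis_norm_nonzero N modesD)
  qed (use p in auto)
  then show ?thesis by (simp add: pairing_def split_def)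
qed

lemma linear_on_mats_zero: "linear_on_mats N D \<Longrightarrow> D (0\<^sub>m N N) = 0\<^sub>m N N"
proof -
  assume D: "linear_on_mats N D"
  have "D (0 \<cdot>\<^sub>m 0\<^sub>m N N) = 0 \<cdot>\<^sub>m D (0\<^sub>m N N)" and c: "D (0\<^sub>m N N) \<in> carrier_mat N N"
    using D unfolding linear_on_mats_def by (blast intro: zero_carrier_mat)+
  moreover have "(0 :: complex) \<cdot>\<^sub>m 0\<^sub>m N N = 0\<^sub>m N N" and "0 \<cdot>\<^sub>m D (0\<^sub>m N N) = 0\<^sub>m N N"
    using c by (auto intro!: eq_matI)
  ultimately show ?thesis by simp
qed

lemma mat_sum_on_carrier [simp]: "mat_sum_on N I F \<in> carrier_mat N N"
  by (simp add: mat_sum_on_def)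

lemma linear_on_mats_sum:
  assumes D: "linear_on_mats N D" and "finite I" and "\<And>a. a \<in> I \<Longrightarrow> F a \<in> carrier_mat N N"
  shows "D (mat_sum_on N I F) = mat_sum_on N I (\<lambda>a. D (F a))"
  using assms(2,3)
proof (induction I rule: finite_induct)
  case empty
  have "mat_sum_on N {} G = 0\<^sub>m N N" for G :: "'a \<Rightarrow> complex mat" by (auto simp: mat_sum_on_def)
  then show ?case by (simp add: linear_on_mats_zero[OF D])
next
  case (insert a I)
  have ins: "mat_sum_on N (insert a I) G = G a + mat_sum_on N I G"
    if "G a \<in> carrier_mat N N" for G :: "'a \<Rightarrow> complex mat"
    using that insert.hyps by (intro eq_matI) (auto simp: mat_sum_on_def)
  have Fa: "F a \<in> carrier_mat N N" "D (F a) \<in> carrier_mat N N"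
    using insert.prems D by (auto simp: linear_on_mats_def)
  have "D (F a + mat_sum_on N I F) = D (F a) + D (mat_sum_on N I F)"
    using D Fa by (simp add: linear_on_mats_def)
  then show ?case using insert.IH insert.prems Fa by (simp add: ins)
qed

lemma T_basis_spans:
  assumes N: "1 \<le> N" and A: "A \<in> carrier_mat N N"
  shows "A = mat_sum_on N (modes N) (\<lambda>(l, m).
     (pairing N A (T_basis N l m) / pairing N (T_basis N l m) (T_basis N l m)) \<cdot>\<^sub>m T_basis N l m)"
  using A
  by (intro eq_matI) (auto simp: mat_sum_on_def T_basis_expansion[OF N, of _ A] split_def intro!: sum.cong)

lemma disc_laplacian_eq:
  assumes N: "1 \<le> N"
  shows "disc_laplacian N = restrict (su2_laplacian N) (carrier_mat N N)"
  unfolding disc_laplacian_def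
proof (rule the_equality)
  let ?D = "restrict (su2_laplacian N) (carrier_mat N N)"
  have "linear_on_mats N ?D"
    using linear_su2_laplacian[of N] by (auto simp: linear_on_mats_def)
  then show "?D \<in> extensional (carrier_mat N N) \<and> linear_on_mats N ?D \<and>
     (\<forall>l m. l \<le> N - 1 \<and> - int l \<le> m \<and> m \<le> int l \<longrightarrow>
        ?D (T_basis N l m) = (- of_nat (l * (l + 1))) \<cdot>\<^sub>m T_basis N l m)"
    using T_basis_eigen[OF N] by (auto simp: abs_le_iff)
next
  fix D assume D: "D \<in> extensional (carrier_mat N N) \<and> linear_on_mats N D \<and>
     (\<forall>l m. l \<le> N - 1 \<and> - int l \<le> m \<and> m \<le> int l \<longrightarrow>
        D (T_basis N l m) = (- of_nat (l * (l + 1))) \<cdot>\<^sub>m T_basis N l m)"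
  have "D A = su2_laplacian N A" if A: "A \<in> carrier_mat N N" for A
  proof -
    let ?F = "\<lambda>(l, m). (pairing N A (T_basis N l m) / pairing N (T_basis N l m) (T_basis N l m)) \<cdot>\<^sub>m T_basis N l m"
    have F: "?F a \<in> carrier_mat N N" for a by (auto split: prod.splits)
    have "D (?F a) = su2_laplacian N (?F a)" if "a \<in> modes N" for a
    proof -
      obtain l m where a: "a = (l, m)" by (cases a)
      with that have lm: "l \<le> N - 1" "- int l \<le> m" "m \<le> int l" by (auto simp: modes_def)
      then have "D (T_basis N l m) = su2_laplacian N (T_basis N l m)"
        using D T_basis_eigen[OF N, of l m] by (simp add: abs_le_iff)
      moreover have "D (c \<cdot>\<^sub>m T_basis N l m) = c \<cdot>\<^sub>m D (T_basis N l m)"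
        and "su2_laplacian N (c \<cdot>\<^sub>m T_basis N l m) = c \<cdot>\<^sub>m su2_laplacian N (T_basis N l m)" for c
        using D linear_su2_laplacian[of N] by (auto simp: linear_on_mats_def)
      ultimately show ?thesis by (simp add: a)
    qed
    then have "mat_sum_on N (modes N) (\<lambda>a. D (?F a)) = mat_sum_on N (modes N) (\<lambda>a. su2_laplacian N (?F a))"
      by (intro mat_sum_on_cong refl)
    then have "D (mat_sum_on N (modes N) ?F) = su2_laplacian N (mat_sum_on N (modes N) ?F)"
      using D linear_su2_laplacian[of N] F by (simp only: linear_on_mats_sum finite_modes)
    then show ?thesis using T_basis_spans[OF N A] by simp
  qed
  then show "D = restrict (su2_laplacian N) (carrier_mat N N)"
    using D by (auto simp: extensional_def restrict_def fun_eq_iff)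
qed

lemma T_basis_0_0:
  assumes N: "1 \<le> N"
  obtains c where "c \<noteq> 0" and "T_basis N 0 0 = c \<cdot>\<^sub>m 1\<^sub>m N"
proof -
  obtain \<kappa> where \<kappa>: "\<kappa> \<noteq> 0" and T: "\<And>i j. i < N \<Longrightarrow> j < N \<Longrightarrow> int i = int j + 0 \<Longrightarrow> T_basis N 0 0 $$ (i, j)
        = complex_of_real (\<kappa> * racah_weight N i * racah_weight N j * racah_sum 0 (N - 1 - 0) 0 (int i))"
    using T_basis_entry[OF N, of 0 0] by auto
  have "T_basis N 0 0 $$ (i, i) = complex_of_real (\<kappa> * fact (N - 1))" if i: "i < N" for i
  proof -
    have "racah_weight N i * racah_weight N i * racah_sum 0 (N - 1) 0 (int i) = fact (N - 1)"
      using i by (simp add: racah_weight_def racah_sum_def jacobi_coeff_def ibinom_def binomial_fact)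
    then show ?thesis using T[OF i i] by (simp add: mult.assoc)
  qed
  then have "T_basis N 0 0 = complex_of_real (\<kappa> * fact (N - 1)) \<cdot>\<^sub>m 1\<^sub>m N"
    by (intro eq_matI) (auto simp: T_basis_off_diagonal)
  moreover have "complex_of_real (\<kappa> * fact (N - 1)) \<noteq> 0" using \<kappa> by simp
  ultimately show ?thesis by (rule that[rotated])
qed

lemma pairing_T_basis_0_0:
  assumes N: "1 \<le> N" and A: "A \<in> carrier_mat N N" and tr: "mtrace A = 0"
  shows "pairing N A (T_basis N 0 0) = 0"
proof -
  obtain c where "T_basis N 0 0 = c \<cdot>\<^sub>m 1\<^sub>m N" using T_basis_0_0[OF N] by metis
  then show ?thesis using A tr by (simp add: pairing_smult pairing_one)
qed

text \<open>Symmetry makes a matrix in the kernel orthogonal to every tensor operator with \<open>l > 0\<close>, and vanishing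
  trace makes it orthogonal to the remaining one, a multiple of the identity. By completeness it is
  zero.\<close>

lemma su2_laplacian_kernel:
  assumes N: "1 \<le> N" and A: "A \<in> traceless N" and 0: "su2_laplacian N A = 0\<^sub>m N N"
  shows "A = 0\<^sub>m N N"
proof (rule eq_matI)
  have Ac: "A \<in> carrier_mat N N" and tr: "mtrace A = 0" using A by (auto simp: traceless_def)
  have pair: "pairing N A (T_basis N l m) = 0" if lm: "(l, m) \<in> modes N" for l m
  proof (cases "l = 0")
    case True
    then show ?thesis using lm pairing_T_basis_0_0[OF N Ac tr] by (simp add: modes_def)
  next
    case False
    have "- of_nat (l * (l + 1)) * pairing N A (T_basis N l m) = pairing N A (su2_laplacian N (T_basis N l m))"
      using lm T_basis_eigen[OF N, of l m] by (auto simp: modes_def pairing_smult)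
    also have "\<dots> = pairing N (su2_laplacian N A) (T_basis N l m)"
      by (rule su2_laplacian_selfadjoint[symmetric])
    also have "\<dots> = 0" unfolding 0 pairing_def by (intro sum.neutral) auto
    finally show ?thesis using False
      by (simp only: mult_eq_0_iff neg_equal_0_iff_equal of_nat_eq_0_iff) simp
  qed
  fix i j assume "i < dim_row (0\<^sub>m N N :: complex mat)" "j < dim_col (0\<^sub>m N N :: complex mat)"
  then have ij: "i < N" "j < N" by auto
  then have "A $$ (i, j) = (\<Sum>(l, m)\<in>modes N. pairing N A (T_basis N l m)
           / pairing N (T_basis N l m) (T_basis N l m) * T_basis N l m $$ (i, j))"
    by (intro T_basis_expansion[OF N]) auto
  also have "\<dots> = 0" by (intro sum.neutral) (auto simp: pair)
  finally show "A $$ (i, j) = 0\<^sub>m N N $$ (i, j)" using ij by simp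
qed (use A in \<open>auto simp: traceless_def\<close>)

lemma mtrace_add: "A \<in> carrier_mat N N \<Longrightarrow> B \<in> carrier_mat N N \<Longrightarrow> mtrace (A + B) = mtrace A + mtrace B"
  by (simp add: mtrace_def sum.distrib)

lemma mtrace_smult: "A \<in> carrier_mat N N \<Longrightarrow> mtrace (c \<cdot>\<^sub>m A) = c * mtrace A"
  by (simp add: mtrace_def sum_distrib_left)

lemma mtrace_one: "mtrace (1\<^sub>m N) = of_nat N"
  by (simp add: mtrace_def)

lemma su2_laplacian_add:
  "A \<in> carrier_mat N N \<Longrightarrow> B \<in> carrier_mat N N \<Longrightarrow> su2_laplacian N (A + B) = su2_laplacian N A + su2_laplacian N B"
  using linear_su2_laplacian[of N] by (auto simp: linear_on_mats_def)

lemma su2_laplacian_smult: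
  "A \<in> carrier_mat N N \<Longrightarrow> su2_laplacian N (c \<cdot>\<^sub>m A) = c \<cdot>\<^sub>m su2_laplacian N A"
  using linear_su2_laplacian[of N] by (auto simp: linear_on_mats_def)

lemma smult_smult_mat: "c \<cdot>\<^sub>m (d \<cdot>\<^sub>m A) = (c * d :: complex) \<cdot>\<^sub>m A"
  by (intro eq_matI) (auto simp: mult.assoc)

lemma inj_su2_laplacian:
  assumes N: "1 \<le> N"
  shows "inj_on (su2_laplacian N) (traceless N)"
proof (rule inj_onI)
  fix A B assume A: "A \<in> traceless N" and B: "B \<in> traceless N" and eq: "su2_laplacian N A = su2_laplacian N B"
  have c: "A \<in> carrier_mat N N" "B \<in> carrier_mat N N" using A B by (auto simp: traceless_def)
  have "su2_laplacian N (A + (-1) \<cdot>\<^sub>m B) = 0\<^sub>m N N"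
    using c by (intro eq_matI) (simp_all add: su2_laplacian_add su2_laplacian_smult eq)
  moreover have "A + (-1) \<cdot>\<^sub>m B \<in> traceless N"
    using A B c by (simp add: traceless_def mtrace_add mtrace_smult)
  ultimately have z: "A + (-1) \<cdot>\<^sub>m B = 0\<^sub>m N N" using su2_laplacian_kernel[OF N] by blast
  show "A = B"
  proof (rule eq_matI)
    fix i j assume "i < dim_row B" "j < dim_col B"
    then show "A $$ (i, j) = B $$ (i, j)" using arg_cong[OF z, of "\<lambda>M. M $$ (i, j)"] c by simp
  qed (use c in auto)
qed

text \<open>The expansion of \<open>X\<close> is divided by the eigenvalues. The division by zero at \<open>l = 0\<close> yields the
  coefficient zero, in agreement with the vanishing trace of \<open>X\<close>.\<close>

lemma surj_su2_laplacian:
  assumes N: "1 \<le> N" and X: "X \<in> traceless N"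
  obtains A where "A \<in> traceless N" and "su2_laplacian N A = X"
proof -
  have Xc: "X \<in> carrier_mat N N" and tr: "mtrace X = 0" using X by (auto simp: traceless_def)
  define x where "x l m = pairing N X (T_basis N l m) / pairing N (T_basis N l m) (T_basis N l m)" for l m
  define F where "F a = (case a of (l, m) \<Rightarrow> (- x l m / of_nat (l * (l + 1))) \<cdot>\<^sub>m T_basis N l m)" for a
  define A where "A = mat_sum_on N (modes N) F"
  have Ac: "A \<in> carrier_mat N N" by (simp add: A_def)
  have "su2_laplacian N A = mat_sum_on N (modes N) (\<lambda>a. su2_laplacian N (F a))"
    unfolding A_def by (rule linear_on_mats_sum[OF linear_su2_laplacian]) (auto simp: F_def)
  also have "\<dots> = mat_sum_on N (modes N) (\<lambda>(l, m). x l m \<cdot>\<^sub>m T_basis N l m)"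
  proof (intro mat_sum_on_cong refl)
    fix a assume "a \<in> modes N"
    then obtain l m where a: "a = (l, m)" and lm: "l \<le> N - 1" "\<bar>m\<bar> \<le> int l" by (auto simp: modes_def)
    have x0: "x l m = 0" if "l = 0"
      using that lm pairing_T_basis_0_0[OF N Xc tr] by (simp add: x_def)
    have "(- x l m / of_nat (l * (l + 1))) * (- of_nat (l * (l + 1))) = x l m"
    proof (cases "l = 0")
      case False
      then have "complex_of_nat (l * (l + 1)) \<noteq> 0" by (simp only: of_nat_eq_0_iff) simp
      then show ?thesis by (simp del: of_nat_mult of_nat_add)
    qed (use x0 in simp)
    then show "su2_laplacian N (F a) = (case a of (l, m) \<Rightarrow> x l m \<cdot>\<^sub>m T_basis N l m)"
      unfolding a F_def prod.case su2_laplacian_smult[OF T_basis_carrier] T_basis_eigen[OF N lm] smult_smult_mat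
      by simp
  qed
  also have "\<dots> = X" unfolding x_def by (rule T_basis_spans[OF N Xc, symmetric])
  finally have lap: "su2_laplacian N A = X" .
  \<comment> \<open>the kernel contains the identity, so the trace of the preimage can be removed\<close>
  define B where "B = A + (- mtrace A / of_nat N) \<cdot>\<^sub>m 1\<^sub>m N"
  have "su2_laplacian N B = X + (- mtrace A / of_nat N) \<cdot>\<^sub>m 0\<^sub>m N N"
    unfolding B_def using Ac by (simp add: su2_laplacian_add su2_laplacian_smult su2_laplacian_one lap)
  also have "\<dots> = X" using Xc by (intro eq_matI) auto
  finally have "su2_laplacian N B = X" .
  moreover have "B \<in> traceless N"
    using Ac N by (simp add: B_def traceless_def mtrace_add[of _ N] mtrace_smult[of _ N] mtrace_one)
  ultimately show ?thesis using that by blast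
qed

definition trace_free :: "nat \<Rightarrow> complex mat \<Rightarrow> complex mat" where
  "trace_free N X = X - (mtrace X / of_nat N) \<cdot>\<^sub>m 1\<^sub>m N"

lemma trace_free_traceless: "1 \<le> N \<Longrightarrow> X \<in> carrier_mat N N \<Longrightarrow> trace_free N X \<in> traceless N"
  by (auto simp: trace_free_def traceless_def mtrace_def sum_subtractf)

lemma disc_stream_solves:
  assumes N: "1 \<le> N" and X: "X \<in> carrier_mat N N"
  shows "disc_stream N X \<in> traceless N" and "su2_laplacian N (disc_stream N X) = trace_free N X"
proof -
  have lap: "disc_laplacian N A = su2_laplacian N A" if "A \<in> traceless N" for A
    using that by (simp add: disc_laplacian_eq[OF N] traceless_def)
  then have inj: "inj_on (disc_laplacian N) (traceless N)"
    using inj_su2_laplacian[OF N] by (simp add: inj_on_def)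
  obtain A where A: "A \<in> traceless N" "su2_laplacian N A = trace_free N X"
    using surj_su2_laplacian[OF N trace_free_traceless[OF N X]] .
  then have "disc_stream N X = A"
    using the_inv_into_f_f[OF inj A(1)] by (simp add: disc_stream_def trace_free_def[symmetric] lap)
  with A show "disc_stream N X \<in> traceless N" and "su2_laplacian N (disc_stream N X) = trace_free N X"
    by simp_all
qed

section \<open>Skew-Hermitian matrices\<close>

lemma mat_adjoint_carrier [simp]: "A \<in> carrier_mat r c \<Longrightarrow> mat_adjoint A \<in> carrier_mat c r"
  by (auto simp: mat_adjoint_def)

lemma mat_adjoint_dim [simp]:
  "dim_row (mat_adjoint (A :: complex mat)) = dim_col A" "dim_col (mat_adjoint A) = dim_row A"
  by (auto simp: mat_adjoint_def)

lemma mat_adjoint_index [simp]: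
  fixes A :: "complex mat"
  shows "i < dim_col A \<Longrightarrow> j < dim_row A \<Longrightarrow> mat_adjoint A $$ (i, j) = cnj (A $$ (j, i))"
  by (simp add: mat_adjoint_def mat_of_rows_index)

lemma su2_laplacian_adjoint:
  assumes A: "A \<in> carrier_mat N N"
  shows "su2_laplacian N (mat_adjoint A) = mat_adjoint (su2_laplacian N A)"
  using A by (intro eq_matI) (simp_all add: su2_laplacian_def conj_commute mult.commute mult.left_commute
      del: of_real_mult of_real_diff of_real_divide)

lemma u_alg_iff:
  "A \<in> u_alg N \<longleftrightarrow> A \<in> carrier_mat N N \<and> (\<forall>i<N. \<forall>j<N. cnj (A $$ (j, i)) = - A $$ (i, j))"
proof -
  have "mat_adjoint A = - A \<longleftrightarrow> (\<forall>i<N. \<forall>j<N. cnj (A $$ (j, i)) = - A $$ (i, j))"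
    if A: "A \<in> carrier_mat N N"
  proof
    assume *: "mat_adjoint A = - A"
    show "\<forall>i<N. \<forall>j<N. cnj (A $$ (j, i)) = - A $$ (i, j)"
    proof (intro allI impI)
      fix i j assume "i < N" "j < N"
      then show "cnj (A $$ (j, i)) = - A $$ (i, j)"
        using arg_cong[OF *, of "\<lambda>M. M $$ (i, j)"] A by simp
    qed
  next
    assume "\<forall>i<N. \<forall>j<N. cnj (A $$ (j, i)) = - A $$ (i, j)"
    then show "mat_adjoint A = - A" using A by (intro eq_matI) auto
  qed
  then show ?thesis by (auto simp: u_alg_def)
qed

text \<open>For skew-Hermitian \<open>X\<close> the negated adjoint of the preimage solves the same traceless equation
  as the preimage itself, so the two agree.\<close>

lemma disc_stream_u_alg:
  assumes N: "1 \<le> N" and X: "X \<in> u_alg N"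
  shows "disc_stream N X \<in> u_alg N"
proof -
  let ?P = "disc_stream N X"
  have Xc: "X \<in> carrier_mat N N" and Xs: "\<And>i j. i < N \<Longrightarrow> j < N \<Longrightarrow> cnj (X $$ (j, i)) = - X $$ (i, j)"
    using X by (auto simp: u_alg_iff)
  have P: "?P \<in> carrier_mat N N" "mtrace ?P = 0" and lap: "su2_laplacian N ?P = trace_free N X"
    using disc_stream_solves[OF N Xc] by (auto simp: traceless_def)
  let ?Q = "(-1) \<cdot>\<^sub>m mat_adjoint ?P"
  have trX: "cnj (mtrace X) = - mtrace X"
    using Xc Xs by (simp add: mtrace_def sum_negf)
  have "mtrace (mat_adjoint ?P) = cnj (mtrace ?P)"
    using P(1) by (simp add: mtrace_def)
  then have "?Q \<in> traceless N"
    using P by (simp add: traceless_def mtrace_smult[of _ N])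
  moreover have "su2_laplacian N ?Q = trace_free N X"
  proof -
    have "su2_laplacian N ?Q = (-1) \<cdot>\<^sub>m mat_adjoint (trace_free N X)"
      using P by (simp add: su2_laplacian_smult su2_laplacian_adjoint lap)
    also have "\<dots> = trace_free N X"
      using Xc Xs trX by (intro eq_matI) (auto simp: trace_free_def)
    finally show ?thesis .
  qed
  ultimately have "?Q = ?P"
    using inj_su2_laplacian[OF N] disc_stream_solves[OF N Xc] by (simp add: inj_on_def lap)
  then have "(?Q :: complex mat) $$ (i, j) = ?P $$ (i, j)" for i j by simp
  then have "cnj (?P $$ (j, i)) = - ?P $$ (i, j)" if "i < N" "j < N" for i j
    using that P by (metis add.inverse_inverse carrier_matD index_smult_mat(1) mat_adjoint_dim
        mat_adjoint_index mult_minus1)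
  then show ?thesis using P by (simp add: u_alg_iff)
qed

lemma mat_adjoint_mult:
  fixes A B :: "complex mat"
  assumes "A \<in> carrier_mat n k" and "B \<in> carrier_mat k m"
  shows "mat_adjoint (A * B) = mat_adjoint B * mat_adjoint A"
  using assms by (intro eq_matI) (auto simp: scalar_prod_def mult.commute intro!: sum.cong)

lemma mat_adjoint_adjoint [simp]: "mat_adjoint (mat_adjoint A) = (A :: complex mat)"
  by (intro eq_matI) auto

lemma mat_adjoint_one [simp]: "mat_adjoint (1\<^sub>m n :: complex mat) = 1\<^sub>m n"
  by (intro eq_matI) auto

lemma u_alg_carrier: "A \<in> u_alg N \<Longrightarrow> A \<in> carrier_mat N N"
  by (simp add: u_alg_def)

lemma u_alg_smult: "A \<in> u_alg N \<Longrightarrow> complex_of_real c \<cdot>\<^sub>m A \<in> u_alg N"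
  by (auto simp: u_alg_iff)

lemma u_alg_minus: "A \<in> u_alg N \<Longrightarrow> B \<in> u_alg N \<Longrightarrow> A - B \<in> u_alg N"
  unfolding u_alg_iff by (auto simp: minus_carrier_mat algebra_simps)

lemma u_alg_minus_adjoint: "A \<in> carrier_mat N N \<Longrightarrow> A - mat_adjoint A \<in> u_alg N"
  unfolding u_alg_iff by (auto intro!: minus_carrier_mat mat_adjoint_carrier)

lemma u_alg_sum: "(\<And>i. i \<in> I \<Longrightarrow> F i \<in> u_alg N) \<Longrightarrow> mat_sum_on N I F \<in> u_alg N"
  by (auto simp: u_alg_iff mat_sum_on_def sum_negf[symmetric] intro!: sum.cong)

lemma u_alg_congruence:
  assumes S: "S \<in> u_alg r" and V: "V \<in> carrier_mat n r"
  shows "V * S * mat_adjoint V \<in> u_alg n"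
proof -
  have Sc: "S \<in> carrier_mat r r" and Sa: "mat_adjoint S = - S" using S by (auto simp: u_alg_def)
  have V': "mat_adjoint V \<in> carrier_mat r n" using V by simp
  have VS: "V * S \<in> carrier_mat n r" using V Sc by simp
  have "mat_adjoint (V * S * mat_adjoint V) = V * (- S * mat_adjoint V)"
    by (simp add: mat_adjoint_mult[OF VS V'] mat_adjoint_mult[OF V Sc] Sa)
  also have "\<dots> = - (V * S * mat_adjoint V)"
    using V V' Sc by (simp add: uminus_mult_left_mat assoc_mult_mat[of V n r S r "mat_adjoint V" n])
  finally have "mat_adjoint (V * S * mat_adjoint V) = - (V * S * mat_adjoint V)" .
  then show ?thesis
    using mult_carrier_mat[OF VS V'] unfolding u_alg_def by (intro CollectI conjI)
qed

text \<open>Eigenvalues of skew-Hermitian matrices are imaginary. This makes the diagonal matrix of eigenvalues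
  skew-Hermitian, and it excludes the eigenvalue 2, so that the Cayley transform is defined.\<close>

lemma skew_hermitian_eigenvalue:
  assumes X: "X \<in> u_alg N" and ev: "eigenvector X v k"
  shows "cnj k = - k"
proof -
  have Xc: "X \<in> carrier_mat N N" and Xs: "\<And>i j. i < N \<Longrightarrow> j < N \<Longrightarrow> cnj (X $$ (j, i)) = - X $$ (i, j)"
    using X by (auto simp: u_alg_iff)
  have v: "v \<in> carrier_vec N" "v \<noteq> 0\<^sub>v N" and Xv: "X *\<^sub>v v = k \<cdot>\<^sub>v v"
    using ev Xc by (auto simp: eigenvector_def)
  have row: "(\<Sum>j<N. X $$ (i, j) * v $ j) = k * v $ i" if "i < N" for i
    using arg_cong[OF Xv, of "\<lambda>w. w $ i"] that Xc v by (simp add: scalar_prod_def lessThan_atLeast0)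
  define q where "q = (\<Sum>i<N. v $ i * cnj (v $ i))"
  have q0: "q \<noteq> 0"
  proof
    assume "q = 0"
    then have "complex_of_real (\<Sum>i<N. (cmod (v $ i))\<^sup>2) = 0"
      unfolding q_def by (simp add: complex_norm_square[symmetric] del: of_real_power)
    then have "(\<Sum>i<N. (cmod (v $ i))\<^sup>2) = 0" by (simp only: of_real_eq_0_iff)
    then have "\<forall>i<N. v $ i = 0" by (subst (asm) sum_nonneg_eq_0_iff) auto
    then show False using v by (auto intro!: eq_vecI)
  qed
  have a: "k * q = (\<Sum>i<N. \<Sum>j<N. cnj (v $ i) * X $$ (i, j) * v $ j)"
  proof -
    have "k * q = (\<Sum>i<N. cnj (v $ i) * (k * v $ i))"
      unfolding q_def sum_distrib_left by (simp add: mult_ac)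
    also have "\<dots> = (\<Sum>i<N. cnj (v $ i) * (\<Sum>j<N. X $$ (i, j) * v $ j))"
      by (intro sum.cong refl) (simp add: row)
    finally show ?thesis by (simp add: sum_distrib_left mult.assoc)
  qed
  have "cnj q = q" by (simp add: q_def mult.commute)
  then have "cnj k * q = cnj (k * q)" by simp
  also have "\<dots> = (\<Sum>i<N. \<Sum>j<N. cnj (v $ j) * cnj (X $$ (i, j)) * v $ i)"
    unfolding a by (simp add: mult_ac)
  also have "\<dots> = (\<Sum>i<N. \<Sum>j<N. - (cnj (v $ j) * X $$ (j, i) * v $ i))"
    by (intro sum.cong refl) (simp add: Xs)
  also have "\<dots> = - (k * q)"
    unfolding a sum_negf by (subst sum.swap) simp
  finally have "cnj k * q = (- k) * q" by simp
  then show ?thesis using q0 by (simp only: mult_cancel_right) simp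
qed

section \<open>The scheme acts by unitary matrices\<close>

lemma U_group_mult:
  assumes "A \<in> U_group N" and "B \<in> U_group N"
  shows "A * B \<in> U_group N"
proof -
  have A: "A \<in> carrier_mat N N" "mat_adjoint A * A = 1\<^sub>m N" "mat_adjoint A \<in> carrier_mat N N"
    and B: "B \<in> carrier_mat N N" "mat_adjoint B * B = 1\<^sub>m N" "mat_adjoint B \<in> carrier_mat N N"
    using assms by (auto simp: U_group_def)
  have "mat_adjoint (A * B) * (A * B) = mat_adjoint B * (mat_adjoint A * (A * B))"
    using A B by (simp add: mat_adjoint_mult[OF A(1) B(1)] assoc_mult_mat[of _ N N _ N _ N])
  also have "mat_adjoint A * (A * B) = B"
    using A B by (simp add: assoc_mult_mat[of _ N N _ N _ N, symmetric])
  finally have left: "mat_adjoint (A * B) * (A * B) = 1\<^sub>m N" using B by simp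
  have AB: "A * B \<in> carrier_mat N N" using A B by simp
  have "(A * B) * mat_adjoint (A * B) = 1\<^sub>m N"
    by (rule mat_mult_left_right_inverse[OF mat_adjoint_carrier[OF AB] AB left])
  then show ?thesis using AB left unfolding U_group_def by (intro CollectI conjI)
qed

text \<open>The two factors \<open>A = I - \<Omega>/2\<close> and \<open>B = I + \<Omega>/2\<close> are adjoint to each other and commute, so
  \<open>A\<^sup>-\<^sup>1 B\<close> times its adjoint \<open>A B\<^sup>-\<^sup>1\<close> is the identity.\<close>

lemma cayley_unitary:
  assumes Om: "\<Omega> \<in> u_alg N"
  shows "cayley N \<Omega> \<in> U_group N"
proof -
  define A where "A = 1\<^sub>m N - (1/2) \<cdot>\<^sub>m \<Omega>"
  define B where "B = 1\<^sub>m N + (1/2) \<cdot>\<^sub>m \<Omega>"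
  have Oc: "\<Omega> \<in> carrier_mat N N" and Os: "\<And>i j. i < N \<Longrightarrow> j < N \<Longrightarrow> cnj (\<Omega> $$ (j, i)) = - \<Omega> $$ (i, j)"
    using Om by (auto simp: u_alg_iff)
  have A: "A \<in> carrier_mat N N" and B: "B \<in> carrier_mat N N"
    using Oc by (auto simp: A_def B_def intro!: minus_carrier_mat)
  have adj: "mat_adjoint A = B" "mat_adjoint B = A"
    using Oc Os by (auto simp: A_def B_def intro!: eq_matI)
  have comm: "B * A = A * B"
  proof -
    let ?H = "(1/2) \<cdot>\<^sub>m \<Omega>"
    have H: "?H \<in> carrier_mat N N" using Oc by simp
    have "B * A = A + ?H * A" unfolding B_def
      by (simp only: add_mult_distrib_mat[OF one_carrier_mat H A] left_mult_one_mat[OF A])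
    also have "?H * A = ?H - ?H * ?H" unfolding A_def by (simp only: mult_minus_distrib_mat[OF H one_carrier_mat H] right_mult_one_mat[OF H])
    also have "?H - ?H * ?H = A * ?H" unfolding A_def
      by (simp only: minus_mult_distrib_mat[OF one_carrier_mat H H] left_mult_one_mat[OF H])
    also have "A + A * ?H = A * B" unfolding B_def
      by (simp only: mult_add_distrib_mat[OF A one_carrier_mat H] right_mult_one_mat[OF A])
    finally show ?thesis .
  qed
  have "det A \<noteq> 0"
  proof
    assume "det A = 0"
    then obtain v where v: "v \<in> carrier_vec N" "v \<noteq> 0\<^sub>v N" "A *\<^sub>v v = 0\<^sub>v N"
      using det_0_iff_vec_prod_zero[OF A] by blast
    have "\<Omega> *\<^sub>v v = 2 \<cdot>\<^sub>v v"
    proof (rule eq_vecI)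
      fix i assume "i < dim_vec (2 \<cdot>\<^sub>v v)"
      then have i: "i < N" using v by simp
      have "(A *\<^sub>v v) $ i = v $ i - (\<Omega> *\<^sub>v v) $ i / 2"
        unfolding A_def minus_mult_distrib_mat_vec[OF one_carrier_mat smult_carrier_mat[OF Oc] v(1)]
        using i v(1) Oc by (simp add: scalar_prod_def sum_divide_distrib mult_ac)
      moreover have "(A *\<^sub>v v) $ i = 0" using v i by simp
      ultimately have "(\<Omega> *\<^sub>v v) $ i = 2 * v $ i" by (simp only: right_minus_eq) (simp only: field_simps, simp)
      then show "(\<Omega> *\<^sub>v v) $ i = (2 \<cdot>\<^sub>v v) $ i" using v i by simp
    qed (use v Oc in auto)
    then have "eigenvector \<Omega> v 2" using v Oc by (simp add: eigenvector_def)
    then have "cnj 2 = - (2 :: complex)" by (rule skew_hermitian_eigenvalue[OF Om])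
    then show False by simp
  qed
  then have "A \<in> Units (ring_mat TYPE(complex) N ())" by (rule det_non_zero_imp_unit[OF A])
  then obtain C where C: "mat_inverse A = Some C" using mat_inverse(1)[OF A, where b = "()"] by (cases "mat_inverse A") auto
  have AC: "A * C = 1\<^sub>m N" "C * A = 1\<^sub>m N" "C \<in> carrier_mat N N" using mat_inverse(2)[OF A C] by auto
  have C': "mat_adjoint C \<in> carrier_mat N N" using AC by simp
  have BC: "B * mat_adjoint C = 1\<^sub>m N"
    using mat_adjoint_mult[OF AC(3) A] AC adj by simp
  have cay: "cayley N \<Omega> = C * B" unfolding cayley_def A_def[symmetric] B_def[symmetric] C by simp
  have adjcay: "mat_adjoint (C * B) = A * mat_adjoint C" using mat_adjoint_mult[OF AC(3) B] adj by simp
  have CB: "C * B \<in> carrier_mat N N" and CB': "mat_adjoint (C * B) \<in> carrier_mat N N"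
    using AC B by (auto intro!: mat_adjoint_carrier mult_carrier_mat)
  have "C * B * mat_adjoint (C * B) = C * ((B * A) * mat_adjoint C)"
    unfolding adjcay using A B AC(3) C' by (simp add: assoc_mult_mat[of _ N N _ N _ N])
  also have "\<dots> = (C * A) * (B * mat_adjoint C)"
    unfolding comm using A B AC(3) C' by (simp add: assoc_mult_mat[of _ N N _ N _ N])
  finally have right: "C * B * mat_adjoint (C * B) = 1\<^sub>m N" by (simp add: AC BC)
  have left: "mat_adjoint (C * B) * (C * B) = 1\<^sub>m N"
    by (rule mat_mult_left_right_inverse[OF CB CB' right])
  show ?thesis using right left CB by (simp add: cay U_group_def)
qed

lemma dcayley_inv_u_alg:
  assumes Om: "\<Omega> \<in> u_alg N" and A: "A \<in> u_alg N"
  shows "dcayley_inv N \<Omega> A \<in> u_alg N"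
proof -
  have "mat_adjoint (1\<^sub>m N - (1/2) \<cdot>\<^sub>m \<Omega>) = 1\<^sub>m N + (1/2) \<cdot>\<^sub>m \<Omega>"
    using Om by (auto simp: u_alg_iff intro!: eq_matI)
  moreover have "1\<^sub>m N - (1/2) \<cdot>\<^sub>m \<Omega> \<in> carrier_mat N N"
    using Om by (auto simp: u_alg_iff intro!: minus_carrier_mat)
  ultimately show ?thesis
    using u_alg_congruence[OF A, of "1\<^sub>m N - (1/2) \<cdot>\<^sub>m \<Omega>" N] by (simp add: dcayley_inv_def)
qed

text \<open>With \<open>G = F U\<^sup>*\<close> and \<open>Q = U U\<^sup>*\<close> the field is \<open>(G - G\<^sup>*) - Q G\<close>. The first part is
  skew-Hermitian by its form, the second as a real multiple of \<open>Q P Q\<close> with the skew-Hermitian stream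
  matrix \<open>P\<close>.\<close>

lemma field_L_u_alg:
  assumes N: "1 \<le> N" and S: "S \<in> u_alg r" and U: "U \<in> carrier_mat N r"
  shows "field_L N S U \<in> u_alg N"
proof -
  define c where "c = - (1 / hbar N)"
  define P where "P = disc_stream N (low_rank S U)"
  define Q where "Q = U * mat_adjoint U"
  define F where "F = field_F N S U"
  define G where "G = F * mat_adjoint U"
  have U': "mat_adjoint U \<in> carrier_mat r N" using U by simp
  have P: "P \<in> u_alg N" unfolding P_def low_rank_def
    by (intro disc_stream_u_alg N u_alg_congruence[OF S U])
  have Pc: "P \<in> carrier_mat N N" by (rule u_alg_carrier[OF P])
  have Q: "Q \<in> carrier_mat N N" using U U' by (simp add: Q_def)
  have Qa: "mat_adjoint Q = Q" using mat_adjoint_mult[OF U U'] by (simp add: Q_def)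
  have F: "F = complex_of_real c \<cdot>\<^sub>m (P * U)" by (simp add: F_def field_F_def P_def c_def)
  have Fc: "F \<in> carrier_mat N r" using Pc U by (simp add: F)
  have Gc: "G \<in> carrier_mat N N" using Fc U' by (simp add: G_def)
  have G: "G = complex_of_real c \<cdot>\<^sub>m (P * Q)"
    unfolding G_def F Q_def mult_smult_assoc_mat[OF mult_carrier_mat[OF Pc U] U'] assoc_mult_mat[OF Pc U U'] ..
  have QG: "Q * G = complex_of_real c \<cdot>\<^sub>m (Q * P * mat_adjoint Q)"
    unfolding G Qa mult_smult_distrib[OF Q mult_carrier_mat[OF Pc Q]] assoc_mult_mat[OF Q Pc Q] ..
  have QGu: "Q * G \<in> u_alg N"
    unfolding QG by (intro u_alg_smult u_alg_congruence[OF P Q])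
  have "field_L N S U = (1\<^sub>m N - Q) * F * mat_adjoint U - U * mat_adjoint F"
    by (simp add: field_L_def Q_def F_def)
  also have "(1\<^sub>m N - Q) * F * mat_adjoint U = (1\<^sub>m N - Q) * G"
    unfolding G_def using Q Fc U' by (intro assoc_mult_mat) (auto intro!: minus_carrier_mat)
  also have "\<dots> = G - Q * G"
    by (simp only: minus_mult_distrib_mat[OF one_carrier_mat Q Gc] left_mult_one_mat[OF Gc])
  also have "U * mat_adjoint F = mat_adjoint G"
    using mat_adjoint_mult[OF Fc U'] by (simp add: G_def)
  also have "G - Q * G - mat_adjoint G = (G - mat_adjoint G) - Q * G"
    using Gc Q by (intro eq_matI) auto
  finally show ?thesis using u_alg_minus[OF u_alg_minus_adjoint[OF Gc] QGu] by simp
qed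

lemma rkmk_stages:
  assumes N: "1 \<le> N" and S: "S \<in> u_alg r" and U: "U \<in> carrier_mat N r"
  shows "rkmk_Om N S dt a U i \<in> u_alg N \<and> rkmk_U N S dt a U i \<in> carrier_mat N r"
proof (induction i rule: less_induct)
  case (less i)
  have Om: "rkmk_Om N S dt a U i \<in> u_alg N"
  proof (cases "i \<le> 1")
    case True
    then show ?thesis by (auto simp: rkmk_Om.simps[of N S dt a U i] u_alg_iff)
  next
    case False
    then show ?thesis
      unfolding rkmk_Om.simps[of N S dt a U i] using less
      by (auto intro!: u_alg_smult u_alg_sum dcayley_inv_u_alg field_L_u_alg[OF N S])
  qed
  have "rkmk_U N S dt a U i \<in> carrier_mat N r"
    using cayley_unitary[OF Om] U by (auto simp: rkmk_U.simps[of N S dt a U i] U_group_def)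
  with Om show ?case by blast
qed

lemma rkmk_step_unitary:
  assumes N: "1 \<le> N" and S: "S \<in> u_alg r" and U: "U \<in> carrier_mat N r"
  obtains R where "R \<in> U_group N" and "rkmk_step N S dt Ns a b U = R * U"
proof -
  have "complex_of_real dt \<cdot>\<^sub>m mat_sum_on N {1..Ns} (\<lambda>i. complex_of_real (b i) \<cdot>\<^sub>m
          dcayley_inv N (rkmk_Om N S dt a U i) (field_L N S (rkmk_U N S dt a U i))) \<in> u_alg N"
    by (intro u_alg_smult u_alg_sum dcayley_inv_u_alg field_L_u_alg[OF N S]
        rkmk_stages[OF N S U, THEN conjunct1] rkmk_stages[OF N S U, THEN conjunct2])
  from that[OF cayley_unitary[OF this]] show ?thesis by (simp only: rkmk_step_def)
qed

section \<open>Traces of powers\<close>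

lemma mtrace_mult_commute:
  assumes "A \<in> carrier_mat n m" and "B \<in> carrier_mat m n"
  shows "mtrace (A * B) = mtrace (B * A)"
proof -
  have "mtrace (A * B) = (\<Sum>i<n. \<Sum>j<m. A $$ (i, j) * B $$ (j, i))"
    using assms by (simp add: mtrace_def scalar_prod_def lessThan_atLeast0)
  also have "\<dots> = (\<Sum>j<m. \<Sum>i<n. B $$ (j, i) * A $$ (i, j))"
    by (subst sum.swap) (simp add: mult.commute)
  also have "\<dots> = mtrace (B * A)"
    using assms by (simp add: mtrace_def scalar_prod_def lessThan_atLeast0)
  finally show ?thesis .
qed

lemma upper_triangular_pow:
  fixes B :: "complex mat"
  assumes B: "B \<in> carrier_mat n n" and ut: "upper_triangular B"
  shows "upper_triangular (B ^\<^sub>m k) \<and> (\<forall>i<n. (B ^\<^sub>m k) $$ (i, i) = B $$ (i, i) ^ k)"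
proof (induction k)
  case 0
  then show ?case using B by auto
next
  case (Suc k)
  let ?C = "B ^\<^sub>m k"
  have C: "?C \<in> carrier_mat n n" using B by simp
  have Cz: "?C $$ (i, j) = 0" if "j < i" "i < n" for i j
    using Suc that C by (auto simp: upper_triangular_def)
  have Bz: "B $$ (i, j) = 0" if "j < i" "i < n" for i j
    using ut that B by (auto simp: upper_triangular_def)
  have ent: "(?C * B) $$ (i, j) = (\<Sum>p<n. ?C $$ (i, p) * B $$ (p, j))" if "i < n" "j < n" for i j
    using that B C by (simp add: scalar_prod_def lessThan_atLeast0)
  have "(?C * B) $$ (i, j) = 0" if "j < i" "i < n" for i j
  proof -
    have "?C $$ (i, p) * B $$ (p, j) = 0" if "p < n" for p
      using Cz[of p i] Bz[of j p] that \<open>j < i\<close> \<open>i < n\<close> by (cases "p < i") auto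
    then have "(\<Sum>p<n. ?C $$ (i, p) * B $$ (p, j)) = 0" by (intro sum.neutral) simp
    then show ?thesis using ent[of i j] that by simp
  qed
  moreover have "(?C * B) $$ (i, i) = B $$ (i, i) ^ Suc k" if i: "i < n" for i
  proof -
    have "(?C * B) $$ (i, i) = (\<Sum>p\<in>{i}. ?C $$ (i, p) * B $$ (p, i))"
      unfolding ent[OF i i]
    proof (rule sum.mono_neutral_right)
      show "\<forall>p\<in>{..<n} - {i}. ?C $$ (i, p) * B $$ (p, i) = 0"
        using Cz[of _ i] Bz[of i] i by (metis DiffE insertI1 lessThan_iff linorder_neqE_nat mult_eq_0_iff singletonI)
    qed (use i in auto)
    then show ?thesis using Suc i by simp
  qed
  ultimately show ?case using B C by (auto simp: upper_triangular_def)
qed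

lemma mtrace_similar:
  assumes "similar_mat_wit A B P Q" and "A \<in> carrier_mat n n"
  shows "mtrace A = mtrace B"
proof -
  note w = similar_mat_witD2[OF assms(2,1)]
  have "mtrace A = mtrace (P * (B * Q))"
    using w by (simp add: assoc_mult_mat[of P n n B n Q n])
  also have "\<dots> = mtrace (B * Q * P)"
    using w by (intro mtrace_mult_commute[of _ n n]) auto
  also have "B * Q * P = B"
    using w by (simp add: assoc_mult_mat[of B n n Q n P n])
  finally show ?thesis .
qed

text \<open>By Schur's theorem the matrix is similar to an upper triangular one, whose powers carry the powers
  of the eigenvalues on the diagonal.\<close>

lemma mtrace_pow_char_poly:
  fixes A :: "complex mat"
  assumes A: "A \<in> carrier_mat n n" and cp: "char_poly A = (\<Prod>j = 1..n. [:- lam j, 1:])"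
  shows "mtrace (A ^\<^sub>m k) = (\<Sum>j = 1..n. lam j ^ k)"
proof -
  define es where "es = map lam [1..<Suc n]"
  have "char_poly A = (\<Prod>e\<leftarrow>es. [:- e, 1:])"
    unfolding cp es_def by (simp add: prod.distinct_set_conv_list[symmetric] comp_def atLeastLessThanSuc_atLeastAtMost
        del: upt_Suc)
  moreover obtain B P Q where BPQ: "schur_decomposition A es = (B, P, Q)" by (cases "schur_decomposition A es") auto
  ultimately have wit: "similar_mat_wit A B P Q" and ut: "upper_triangular B" and diag: "diag_mat B = es"
    using schur_decomposition[OF A] by blast+
  have B: "B \<in> carrier_mat n n" using similar_mat_witD2[OF A wit] by simp
  have Bd: "B $$ (i, i) = lam (Suc i)" if "i < n" for i
  proof -
    have "diag_mat B ! i = B $$ (i, i)" using that B by (simp add: diag_mat_def)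
    then show ?thesis unfolding diag es_def using that by (simp del: upt_Suc)
  qed
  have "mtrace (A ^\<^sub>m k) = mtrace (B ^\<^sub>m k)"
    using A by (intro mtrace_similar[OF similar_mat_wit_pow[OF wit]]) auto
  also have "\<dots> = (\<Sum>i<n. lam (Suc i) ^ k)"
    using upper_triangular_pow[OF B ut, of k] B by (auto simp: mtrace_def Bd)
  also have "\<dots> = (\<Sum>j = 1..n. lam j ^ k)"
    by (rule sum.reindex_bij_witness[of _ "\<lambda>j. j - 1" Suc]) auto
  finally show ?thesis .
qed

text \<open>Because \<open>U\<^sup>* U = I\<close>, the map \<open>X \<mapsto> U X U\<^sup>*\<close> is multiplicative.\<close>

lemma stiefel_congruence_mult:
  assumes U: "U \<in> stiefel r N" and X: "X \<in> carrier_mat r r" and Y: "Y \<in> carrier_mat r r"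
  shows "(U * X * mat_adjoint U) * (U * Y * mat_adjoint U) = U * (X * Y) * mat_adjoint U"
proof -
  let ?U' = "mat_adjoint U"
  have Uc: "U \<in> carrier_mat N r" and UU: "?U' * U = 1\<^sub>m r" and U': "?U' \<in> carrier_mat r N"
    using U by (auto simp: stiefel_def)
  have YU: "Y * ?U' \<in> carrier_mat r N" and UX: "U * X \<in> carrier_mat N r" using Uc U' X Y by auto
  have "(U * X * ?U') * (U * Y * ?U') = U * X * (?U' * (U * (Y * ?U')))"
    using assoc_mult_mat[OF UX U', of "U * (Y * ?U')" N] assoc_mult_mat[OF Uc Y U'] Uc YU by simp
  also have "?U' * (U * (Y * ?U')) = Y * ?U'"
    unfolding assoc_mult_mat[OF U' Uc YU, symmetric] UU by (rule left_mult_one_mat[OF YU])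
  also have "U * X * (Y * ?U') = U * (X * Y) * ?U'"
    using assoc_mult_mat[OF Uc X YU] assoc_mult_mat[OF X Y U'] assoc_mult_mat[OF Uc _ U', of "X * Y"] X Y by simp
  finally show ?thesis .
qed

lemma mtrace_low_rank_pow:
  assumes U: "U \<in> stiefel r N" and k: "1 \<le> k"
  shows "mtrace ((U * mat_diag r d * mat_adjoint U) ^\<^sub>m k) = (\<Sum>i<r. d i ^ k)"
proof -
  let ?S = "\<lambda>k. mat_diag r (\<lambda>i. d i ^ k)"
  have Uc: "U \<in> carrier_mat N r" and UU: "mat_adjoint U * U = 1\<^sub>m r" and U': "mat_adjoint U \<in> carrier_mat r N"
    using U by (auto simp: stiefel_def)
  have S: "?S k \<in> carrier_mat r r" for k by (simp add: mat_diag_def)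
  have S1: "mat_diag r d = ?S 1" by simp
  have "(U * ?S 1 * mat_adjoint U) ^\<^sub>m Suc n = U * ?S (Suc n) * mat_adjoint U" for n
  proof (induction n)
    case 0
    then show ?case using Uc U' S[of 1] by simp
  next
    case (Suc n)
    have "(U * ?S 1 * mat_adjoint U) ^\<^sub>m Suc (Suc n) = U * ?S (Suc n) * mat_adjoint U * (U * ?S 1 * mat_adjoint U)"
      using Suc by simp
    also have "\<dots> = U * (?S (Suc n) * ?S 1) * mat_adjoint U"
      by (rule stiefel_congruence_mult[OF U S S])
    also have "?S (Suc n) * ?S 1 = ?S (Suc (Suc n))"
      by (simp add: mult_ac)
    finally show ?case .
  qed
  from this[of "k - 1"] have "(U * mat_diag r d * mat_adjoint U) ^\<^sub>m k = U * ?S k * mat_adjoint U"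
    using k by simp
  also have "mtrace \<dots> = mtrace (mat_adjoint U * (U * ?S k))"
    using Uc U' S[of k] by (intro mtrace_mult_commute[of _ N r]) auto
  also have "mat_adjoint U * (U * ?S k) = ?S k"
    unfolding assoc_mult_mat[OF U' Uc S, symmetric] UU by (rule left_mult_one_mat[OF S])
  also have "mtrace (?S k) = (\<Sum>i<r. d i ^ k)" by (simp add: mtrace_def mat_diag_def)
  finally show ?thesis .
qed

section \<open>Isospectrality of the Euler flow\<close>

lemma mat_has_derivative_mult:
  assumes F: "mat_has_derivative N F F' (at t within J)" and G: "mat_has_derivative N G G' (at t within J)"
    and car: "\<And>s. s \<in> J \<Longrightarrow> F s \<in> carrier_mat N N" "\<And>s. s \<in> J \<Longrightarrow> G s \<in> carrier_mat N N"
      "F' \<in> carrier_mat N N" "G' \<in> carrier_mat N N" and t: "t \<in> J"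
  shows "mat_has_derivative N (\<lambda>s. F s * G s) (F' * G t + F t * G') (at t within J)"
  unfolding mat_has_derivative_def
proof (intro allI impI)
  fix i j assume ij: "i < N" "j < N"
  have "((\<lambda>s. \<Sum>p<N. F s $$ (i, p) * G s $$ (p, j)) has_vector_derivative
      (\<Sum>p<N. F t $$ (i, p) * G' $$ (p, j) + F' $$ (i, p) * G t $$ (p, j))) (at t within J)"
    using F G ij unfolding mat_has_derivative_def
    by (intro has_vector_derivative_sum has_vector_derivative_mult) auto
  also have "(\<Sum>p<N. F t $$ (i, p) * G' $$ (p, j) + F' $$ (i, p) * G t $$ (p, j)) = (F' * G t + F t * G') $$ (i, j)"
    using ij car(3,4) car(1)[OF t] car(2)[OF t]
    by (simp add: scalar_prod_def lessThan_atLeast0 sum.distrib add.commute)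
  finally have "((\<lambda>s. \<Sum>p<N. F s $$ (i, p) * G s $$ (p, j)) has_vector_derivative (F' * G t + F t * G') $$ (i, j)) (at t within J)" .
  moreover have "(F s * G s) $$ (i, j) = (\<Sum>p<N. F s $$ (i, p) * G s $$ (p, j))" if "s \<in> J" for s
    using ij car(1,2)[OF that] by (simp add: scalar_prod_def lessThan_atLeast0)
  ultimately show "((\<lambda>s. (F s * G s) $$ (i, j)) has_vector_derivative (F' * G t + F t * G') $$ (i, j)) (at t within J)"
    by (rule has_vector_derivative_transform[OF t, rotated]) assumption
qed

text \<open>The commutator with a fixed \<open>B\<close> is a derivation, so the Lax equation is inherited by powers.\<close>

lemma lax_flow_pow_derivative:
  assumes W: "mat_has_derivative N W (W t * B - B * W t) (at t within J)"
    and car: "\<And>s. s \<in> J \<Longrightarrow> W s \<in> carrier_mat N N" and B: "B \<in> carrier_mat N N" and t: "t \<in> J"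
  shows "mat_has_derivative N (\<lambda>s. W s ^\<^sub>m k) (W t ^\<^sub>m k * B - B * W t ^\<^sub>m k) (at t within J)"
proof (induction k)
  case 0
  have "1\<^sub>m N * B - B * 1\<^sub>m N = 0\<^sub>m N N" using B by simp
  moreover have "W s ^\<^sub>m 0 = 1\<^sub>m N" if "s \<in> J" for s using car[OF that] by simp
  ultimately show ?case
    using t by (auto simp: mat_has_derivative_def intro!: has_vector_derivative_transform[OF t _ has_vector_derivative_const])
next
  case (Suc k)
  let ?A = "W t" and ?C = "W t ^\<^sub>m k"
  have A: "?A \<in> carrier_mat N N" and C: "?C \<in> carrier_mat N N" using car[OF t] by simp_all
  have prods: "?C * B \<in> carrier_mat N N" "B * ?C \<in> carrier_mat N N" "?A * B \<in> carrier_mat N N" "B * ?A \<in> carrier_mat N N"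
    using A B C by auto
  have "mat_has_derivative N (\<lambda>s. W s ^\<^sub>m k * W s) ((?C * B - B * ?C) * ?A + ?C * (?A * B - B * ?A)) (at t within J)"
    by (rule mat_has_derivative_mult[OF Suc W]) (use car prods t in \<open>auto intro!: minus_carrier_mat\<close>)
  moreover have "(?C * B - B * ?C) * ?A + ?C * (?A * B - B * ?A) = ?C * ?A * B - B * (?C * ?A)"
  proof -
    have c: "?C * B * ?A \<in> carrier_mat N N" "B * (?C * ?A) \<in> carrier_mat N N" "?C * ?A * B \<in> carrier_mat N N"
      using A B C by auto
    have d1: "(?C * B - B * ?C) * ?A = ?C * B * ?A - B * (?C * ?A)"
      unfolding minus_mult_distrib_mat[OF prods(1,2) A] assoc_mult_mat[OF B C A] ..
    have d2: "?C * (?A * B - B * ?A) = ?C * ?A * B - ?C * B * ?A"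
      unfolding mult_minus_distrib_mat[OF C prods(3,4)] assoc_mult_mat[OF C A B] assoc_mult_mat[OF C B A] ..
    have "X - Y + (Z - X) = Z - Y"
      if "X \<in> carrier_mat N N" "Y \<in> carrier_mat N N" "Z \<in> carrier_mat N N" for X Y Z :: "complex mat"
      using that by (intro eq_matI) auto
    from this[OF c] show ?thesis unfolding d1 d2 .
  qed
  ultimately show ?case by simp
qed

lemma lax_flow_mtrace_pow_const:
  assumes J: "is_interval J" and t0: "t0 \<in> J" and t: "t \<in> J"
    and car: "\<And>s. s \<in> J \<Longrightarrow> W s \<in> carrier_mat N N"
    and W: "\<And>s. s \<in> J \<Longrightarrow> \<exists>B\<in>carrier_mat N N. mat_has_derivative N W (W s * B - B * W s) (at s within J)"
  shows "mtrace (W t ^\<^sub>m k) = mtrace (W t0 ^\<^sub>m k)"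
proof -
  have D: "((\<lambda>s. \<Sum>i<N. (W s ^\<^sub>m k) $$ (i, i)) has_vector_derivative 0) (at s within J)" if s: "s \<in> J" for s
  proof -
    obtain B where B: "B \<in> carrier_mat N N" "mat_has_derivative N W (W s * B - B * W s) (at s within J)"
      using W[OF s] by blast
    let ?C = "W s ^\<^sub>m k"
    have C: "?C \<in> carrier_mat N N" using car[OF s] by simp
    have "mat_has_derivative N (\<lambda>s. W s ^\<^sub>m k) (?C * B - B * ?C) (at s within J)"
      using lax_flow_pow_derivative[OF B(2) car B(1) s] by blast
    then have "((\<lambda>s. \<Sum>i<N. (W s ^\<^sub>m k) $$ (i, i)) has_vector_derivative (\<Sum>i<N. (?C * B - B * ?C) $$ (i, i))) (at s within J)"
      unfolding mat_has_derivative_def by (intro has_vector_derivative_sum) auto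
    moreover have "(\<Sum>i<N. (?C * B - B * ?C) $$ (i, i)) = mtrace (?C * B) - mtrace (B * ?C)"
      using B C car[OF s] by (simp add: mtrace_def sum_subtractf)
    ultimately show ?thesis using mtrace_mult_commute[OF C B(1)] by simp
  qed
  obtain c where "\<And>s. s \<in> J \<Longrightarrow> (\<Sum>i<N. (W s ^\<^sub>m k) $$ (i, i)) = c"
    by (rule has_vector_derivative_zero_constant[OF is_interval_convex[OF J] D], assumption, rule that)
  moreover have "mtrace (W s ^\<^sub>m k) = (\<Sum>i<N. (W s ^\<^sub>m k) $$ (i, i))" if "s \<in> J" for s
    using car[OF that] by (simp add: mtrace_def)
  ultimately show ?thesis using t t0 by simp
qed

text \<open>The Euler equation is of Lax form with \<open>B\<close> the stream matrix divided by \<open>hbar N\<close>.\<close>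

lemma solves_euler_mtrace_pow:
  assumes N: "1 \<le> N" and J: "is_interval J" and t0: "t0 \<in> J" and t: "t \<in> J"
    and W: "solves_euler N J t0 W0 W"
  shows "mtrace (W t ^\<^sub>m k) = mtrace (W0 ^\<^sub>m k)"
proof -
  have car: "W s \<in> carrier_mat N N" if "s \<in> J" for s using W that by (simp add: solves_euler_def)
  have "\<exists>B\<in>carrier_mat N N. mat_has_derivative N W (W s * B - B * W s) (at s within J)" if s: "s \<in> J" for s
  proof -
    define h where "h = complex_of_real (1 / hbar N)"
    define P where "P = disc_stream N (W s)"
    obtain W' where W': "W' \<in> carrier_mat N N" "mat_has_derivative N W W' (at s within J)"
      and eq: "W' + bracket N P (W s) = 0\<^sub>m N N"
      using W s by (auto simp: solves_euler_def P_def)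
    have P: "P \<in> carrier_mat N N"
      using disc_stream_solves(1)[OF N car[OF s]] by (simp add: P_def traceless_def)
    note A = car[OF s]
    define X where "X = W s * P"
    define Y where "Y = P * W s"
    have XY: "X \<in> carrier_mat N N" "Y \<in> carrier_mat N N" using A P by (auto simp: X_def Y_def)
    have "W' = h \<cdot>\<^sub>m X - h \<cdot>\<^sub>m Y"
    proof (rule eq_matI)
      fix i j assume "i < dim_row (h \<cdot>\<^sub>m X - h \<cdot>\<^sub>m Y)" "j < dim_col (h \<cdot>\<^sub>m X - h \<cdot>\<^sub>m Y)"
      then have ij: "i < N" "j < N" using XY by auto
      have "W' + h \<cdot>\<^sub>m (Y - X) = 0\<^sub>m N N" using eq by (simp only: bracket_def h_def X_def Y_def)
      from arg_cong[OF this, of "\<lambda>M. M $$ (i, j)"] have "W' $$ (i, j) + h * (Y $$ (i, j) - X $$ (i, j)) = 0"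
        using ij XY W' by simp
      then have "W' $$ (i, j) = h * X $$ (i, j) - h * Y $$ (i, j)"
        by (simp add: add_eq_0_iff algebra_simps)
      then show "W' $$ (i, j) = (h \<cdot>\<^sub>m X - h \<cdot>\<^sub>m Y) $$ (i, j)" using ij XY by simp
    qed (use W' XY in auto)
    also have "\<dots> = W s * (h \<cdot>\<^sub>m P) - (h \<cdot>\<^sub>m P) * W s"
      unfolding X_def Y_def mult_smult_distrib[OF A P] mult_smult_assoc_mat[OF P A] ..
    finally have "W' = W s * (h \<cdot>\<^sub>m P) - (h \<cdot>\<^sub>m P) * W s" .
    then show ?thesis using W' P by (intro bexI[of _ "h \<cdot>\<^sub>m P"]) auto
  qed
  from lax_flow_mtrace_pow_const[OF J t0 t car this] show ?thesis
    using W by (simp add: solves_euler_def)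
qed

section \<open>The discrete flow\<close>

lemma unitary_stiefel:
  assumes R: "R \<in> U_group N" and U: "U \<in> stiefel r N"
  shows "R * U \<in> stiefel r N"
proof -
  have R': "R \<in> carrier_mat N N" "mat_adjoint R * R = 1\<^sub>m N" "mat_adjoint R \<in> carrier_mat N N"
    using R by (auto simp: U_group_def)
  have U': "U \<in> carrier_mat N r" "mat_adjoint U * U = 1\<^sub>m r" "mat_adjoint U \<in> carrier_mat r N"
    using U by (auto simp: stiefel_def)
  have RU: "R * U \<in> carrier_mat N r" using R' U' by simp
  have "mat_adjoint (R * U) * (R * U) = mat_adjoint U * (mat_adjoint R * (R * U))"
    unfolding mat_adjoint_mult[OF R'(1) U'(1)] by (rule assoc_mult_mat[OF U'(3) R'(3) RU])
  also have "mat_adjoint R * (R * U) = U"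
    unfolding assoc_mult_mat[OF R'(3) R'(1) U'(1), symmetric] R'(2) by (rule left_mult_one_mat[OF U'(1)])
  finally show ?thesis using RU U'(2) by (simp add: stiefel_def)
qed

lemma unitary_congruence:
  fixes R S U :: "complex mat"
  assumes R: "R \<in> carrier_mat N N" and U: "U \<in> carrier_mat N r" and S: "S \<in> carrier_mat r r"
  shows "(R * U) * S * mat_adjoint (R * U) = R * (U * S * mat_adjoint U) * mat_adjoint R"
proof -
  have c: "mat_adjoint U \<in> carrier_mat r N" "mat_adjoint R \<in> carrier_mat N N" using R U by simp_all
  have c2: "mat_adjoint U * mat_adjoint R \<in> carrier_mat r N" "S * mat_adjoint U \<in> carrier_mat r N"
    by (rule mult_carrier_mat[OF c]) (rule mult_carrier_mat[OF S c(1)])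
  have c3: "S * (mat_adjoint U * mat_adjoint R) \<in> carrier_mat r N" "U * (S * mat_adjoint U) \<in> carrier_mat N N"
    by (rule mult_carrier_mat[OF S c2(1)]) (rule mult_carrier_mat[OF U c2(2)])
  have "(R * U) * S * mat_adjoint (R * U) = R * (U * (S * (mat_adjoint U * mat_adjoint R)))"
    unfolding mat_adjoint_mult[OF R U] assoc_mult_mat[OF mult_carrier_mat[OF R U] S c2(1)]
    by (rule assoc_mult_mat[OF R U c3(1)])
  also have "\<dots> = R * (U * S * mat_adjoint U) * mat_adjoint R"
    unfolding assoc_mult_mat[OF U S c(1)] assoc_mult_mat[OF R c3(2) c(2)] assoc_mult_mat[OF U c2(2) c(2)]
      assoc_mult_mat[OF S c(1) c(2)] ..
  finally show ?thesis .
qed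

lemma coadjoint_orbit_isospectral:
  assumes Y: "Y \<in> carrier_mat N N" and X: "X \<in> coadjoint_orbit N Y"
  shows "isospectral X Y"
proof -
  obtain R where R: "R \<in> U_group N" and XR: "X = R * Y * mat_adjoint R"
    using X by (auto simp: coadjoint_orbit_def)
  have R': "R \<in> carrier_mat N N" "mat_adjoint R * R = 1\<^sub>m N" "R * mat_adjoint R = 1\<^sub>m N"
    "mat_adjoint R \<in> carrier_mat N N"
    using R by (auto simp: U_group_def)
  have Xc: "X \<in> carrier_mat N N"
    unfolding XR by (rule mult_carrier_mat[OF mult_carrier_mat[OF R'(1) Y] R'(4)])
  have "similar_mat X Y"
    by (rule similar_matI[of X Y R "mat_adjoint R" N]) (use R' Xc Y in \<open>simp_all only: XR, auto\<close>)
  then have "char_poly X = char_poly Y" by (rule char_poly_similar)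
  then show ?thesis
    unfolding isospectral_def eigenvalue_root_char_poly[OF Xc] eigenvalue_root_char_poly[OF Y] by simp
qed

theorem mainTheorem6:
  fixes N r Ns :: nat
    and W0 U0 S0 :: "complex mat"
    and lam :: "nat \<Rightarrow> complex"
    and W :: "real \<Rightarrow> complex mat"
    and J :: "real set"
    and t0 dt :: real
    and a :: "nat \<Rightarrow> nat \<Rightarrow> real"
    and b :: "nat \<Rightarrow> real"
    and U Y :: "nat \<Rightarrow> complex mat"
  assumes N: "2 \<le> N"
    and r: "1 \<le> r" "r \<le> N"
    and W0: "W0 \<in> su_alg N"
    and lam_eigenvalues: "char_poly W0 = (\<Prod>j = 1..N. [:- lam j, 1:])"
    and lam_ordered: "\<And>i j. 1 \<le> i \<Longrightarrow> i \<le> j \<Longrightarrow> j \<le> N \<Longrightarrow> cmod (lam j) \<le> cmod (lam i)"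
    and S0: "S0 = mat_diag r (\<lambda>i. lam (Suc i))"
    and U0: "U0 \<in> stiefel r N"
    and U0_eigenvectors: "\<And>j. j < r \<Longrightarrow> eigenvector W0 (col U0 j) (lam (Suc j))"
    and J: "is_interval J" "t0 \<in> J" "\<And>\<tau>::nat. t0 + real \<tau> * dt \<in> J"
    and W: "solves_euler N J t0 W0 W"
    and explicit: "\<And>i j. i \<in> {1..Ns} \<Longrightarrow> j \<in> {i..Ns} \<Longrightarrow> a i j = 0"
    and U_init: "U 0 = U0"
    and U_step: "\<And>\<tau>. U (Suc \<tau>) = rkmk_step N S0 dt Ns a b (U \<tau>)"
    and Y: "\<And>\<tau>. Y \<tau> = U \<tau> * S0 * mat_adjoint (U \<tau>)"
  shows "\<forall>\<tau>. U \<tau> \<in> stiefel r N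
      \<and> Y \<tau> \<in> u_alg N
      \<and> Y \<tau> \<in> coadjoint_orbit N (Y 0)
      \<and> isospectral (Y \<tau>) (Y 0)
      \<and> (\<forall>k\<in>{1..N}. casimir N k (Y \<tau>) = casimir N k (Y 0))
      \<and> (\<forall>k\<in>{1..N}. cmod (casimir N k (W (t0 + real \<tau> * dt)) - casimir N k (Y \<tau>))
            = 4 * pi / real N * cmod (\<Sum>j = r + 1..N. lam j ^ k))"
proof -
  have N1: "1 \<le> N" using N by simp
  have W0u: "W0 \<in> u_alg N" and W0c: "W0 \<in> carrier_mat N N" using W0 by (auto simp: su_alg_def u_alg_def)
  have U0c: "U0 \<in> carrier_mat N r" using U0 by (simp add: stiefel_def)
  have "cnj (lam (Suc j)) = - lam (Suc j)" if "j < r" for j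
    using skew_hermitian_eigenvalue[OF W0u U0_eigenvectors[OF that]] .
  then have S0u: "S0 \<in> u_alg r" by (auto simp: u_alg_iff S0 mat_diag_def)
  have S0c: "S0 \<in> carrier_mat r r" by (rule u_alg_carrier[OF S0u])
  have flow: "\<exists>R \<in> U_group N. U \<tau> = R * U0" for \<tau>
  proof (induction \<tau>)
    case 0
    have "(1\<^sub>m N :: complex mat) \<in> U_group N" by (simp add: U_group_def)
    then show ?case using U0c by (intro bexI[of _ "1\<^sub>m N"]) (simp_all add: U_init)
  next
    case (Suc \<tau>)
    then obtain R where R: "R \<in> U_group N" "U \<tau> = R * U0" by blast
    have Rc: "R \<in> carrier_mat N N" using R by (simp add: U_group_def)
    have "U \<tau> \<in> carrier_mat N r" unfolding R(2) by (rule mult_carrier_mat[OF Rc U0c])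
    from rkmk_step_unitary[OF N1 S0u this]
    obtain Q where Q: "Q \<in> U_group N" "U (Suc \<tau>) = Q * U \<tau>" unfolding U_step by metis
    have Qc: "Q \<in> carrier_mat N N" using Q by (simp add: U_group_def)
    have "U (Suc \<tau>) = (Q * R) * U0" unfolding Q(2) R(2) by (rule assoc_mult_mat[OF Qc Rc U0c, symmetric])
    then show ?case using U_group_mult[OF Q(1) R(1)] by blast
  qed
  have Y0: "Y 0 = U0 * S0 * mat_adjoint U0" by (simp add: Y U_init)
  have Y0u: "Y 0 \<in> u_alg N" unfolding Y0 by (rule u_alg_congruence[OF S0u U0c])
  have all: "U \<tau> \<in> stiefel r N \<and> Y \<tau> \<in> u_alg N \<and> Y \<tau> \<in> coadjoint_orbit N (Y 0)" for \<tau>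
  proof -
    obtain R where R: "R \<in> U_group N" "U \<tau> = R * U0" using flow by blast
    have Rc: "R \<in> carrier_mat N N" using R by (simp add: U_group_def)
    have st: "U \<tau> \<in> stiefel r N" unfolding R(2) by (rule unitary_stiefel[OF R(1) U0])
    then have "Y \<tau> \<in> u_alg N" unfolding Y by (intro u_alg_congruence[OF S0u]) (simp add: stiefel_def)
    moreover have "Y \<tau> = R * Y 0 * mat_adjoint R"
      unfolding Y[of \<tau>] R(2) Y0 by (rule unitary_congruence[OF Rc U0c S0c])
    ultimately show ?thesis using st R(1) unfolding coadjoint_orbit_def by blast
  qed
  have trY: "mtrace (Y \<tau> ^\<^sub>m k) = (\<Sum>j = 1..r. lam j ^ k)" if "1 \<le> k" for \<tau> k
  proof -
    have "mtrace (Y \<tau> ^\<^sub>m k) = (\<Sum>i<r. lam (Suc i) ^ k)"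
      unfolding Y S0 using all that by (intro mtrace_low_rank_pow) auto
    also have "\<dots> = (\<Sum>j = 1..r. lam j ^ k)"
      by (rule sum.reindex_bij_witness[of _ "\<lambda>j. j - 1" Suc]) auto
    finally show ?thesis .
  qed
  have trW: "mtrace (W (t0 + real \<tau> * dt) ^\<^sub>m k) = (\<Sum>j = 1..N. lam j ^ k)" for \<tau> k
    using solves_euler_mtrace_pow[OF N1 J(1,2) J(3) W] mtrace_pow_char_poly[OF W0c lam_eigenvalues] by simp
  have diff: "cmod (casimir N k (W (t0 + real \<tau> * dt)) - casimir N k (Y \<tau>))
      = 4 * pi / real N * cmod (\<Sum>j = r + 1..N. lam j ^ k)" if "1 \<le> k" for \<tau> k
  proof -
    have "(\<Sum>j = 1..N. lam j ^ k) = (\<Sum>j = 1..r. lam j ^ k) + (\<Sum>j = r + 1..N. lam j ^ k)"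
      using r by (subst sum.union_disjoint[symmetric]) (auto intro!: sum.cong)
    then have "casimir N k (W (t0 + real \<tau> * dt)) - casimir N k (Y \<tau>)
        = complex_of_real (4 * pi / real N) * (\<Sum>j = r + 1..N. lam j ^ k)"
      unfolding casimir_def trW trY[OF that] by (simp add: algebra_simps)
    then show ?thesis by (simp only: norm_mult norm_of_real) simp
  qed
  show ?thesis
    using all diff trY coadjoint_orbit_isospectral[OF u_alg_carrier[OF Y0u]]
    by (auto simp: casimir_def)
qed

end
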